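(* Let $(X,Y)$ be an $r$-separable pair of directed graphs with $2\le r<\infty$. For $A=X,Y$ let $i_A\colon X\cap Y\to A$ and $j_A\colon A\to X\cup Y$ denote the inclusions. If $X$, $Y$ and $X\cap Y$ are connected, then the sequence $$E_{1,0}^r(X\cap Y)\xrightarrow{((i_X)_*,(i_Y)_* )}E_{1,0}^r(X)\oplus E_{1,0}^r(Y)\xrightarrow{(j_X)_*-(j_Y)_*}E_{1,0}^r(X\cup Y)\to 0$$ is exact.
   Context: A directed graph $X$ consists of a vertex set $V(X)$ and an edge set $E(X)\subset V(X)\times V(X)-\Delta$, where $\Delta$ is the diagonal. A map $f\colon X\to Y$ is a function $V(X)\to V(Y)$ such that for every $(x,y)\in E(X)$ either $(f(x),f(y))\in E(Y)$ or $f(x)=f(y)$; it is a homomorphism if always $(f(x),f(y))\in E(Y)$. Unions and intersections of directed graphs are taken on vertex sets and edge sets. A directed graph is connected if any two vertices are connected by a zig-zag of finitely many edges. For vertices $x,y$, $d(x,y)$ is the minimal length of a directed edge path from $x$ to $y$ ($\infty$ if none), and $L(x_0,\ldots,x_n)=\sum_{i=0}^{n-1}d(x_i,x_{i+1})$. $\mathrm{RC}_n(X)$ is the free abelian group on tuples $(x_0,\ldots,x_n)\in V(X)^{n+1}$ with $L(x_0,\ldots,x_n)<\infty$ and $x_i\ne x_{i+1}$ for all $i$, with $\partial(x_0,\ldots,x_n)=\sum_{i=0}^n(-1)^i(x_0,\ldots,\widehat{x_i},\ldots,x_n)$, where tuples with two equal consecutive entries are set to $0$. $F_p\mathrm{RC}_*(X)$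 is the subcomplex spanned by generators with $L\le p$. The magnitude-path spectral sequence $E^r_{p,q}(X)$ is the homology spectral sequence of this filtration (standard indexing, $p$ filtration degree, $p+q$ total degree, $d^r$ of bidegree $(-r,r-1)$): $E^r_{p,q}=Z^r_{p,q}/(Z^{r-1}_{p-1,q+1}+\partial Z^{r-1}_{p+r-1,q-r+2})$ with $Z^r_{p,q}=\{c\in F_p\mathrm{RC}_{p+q}(X)\mid\partial c\in F_{p-r}\mathrm{RC}_{p+q-1}(X)\}$. It is functorial for maps. Paths: $\mathcal{I}_0$ consists of the one-vertex graph with vertex $0$; for $n\ge1$, $\mathcal{I}_n$ is the set of directed graphs with vertex set $\{0,\ldots,n\}$ having exactly one of the edges $(i,i+1)$, $(i+1,i)$ for each $0\le i<n$ and no other edges. A path in $X$ is a map $f\colon I_n\to X$ with $I_n\in\mathcal{I}_n$; it is reduced if it is a homomorphism, and is a loop if $f(0)=f(n)$. A subpath of a reduced path $f\colon I\to X$, $I\in\mathcal{I}_n$, is its restriction to the induced subgraph of $I$ on $\{k,\ldots,l\}$ for some $0\le k\le l\le n$. A subgraph is represented by a path if it is the image of that path. For a subgraph $A$ of $X$, the complement $X-A$ is the smallest subgraph of $X$ with $X=(X-A)\cup A$; explicitly $E(X-A)=E(X)-E(A)$, and $V(X-A)$ is $V(X)-V(A)$ together with all endpoints of edges in $E(X-A)$. Subdivision: let $L$ be a subgraph of $X$ represented by a reduced loop. A subdivision of $L$ consists of two subgraphs $L_1,L_2$ of $X$ represented by reduced loops such that $L_1\cap L_2$ is represented by subpaths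 of $L_1$, $L_2$ and $L=L_1\cup L_2-L_1\cap L_2$. Subdividing iteratively, the resulting subgraphs $L_1,\ldots,L_n$ represented by reduced loops are also called a subdivision of $L$. For $r\ge2$, $\Gamma_r$ is the directed graph with vertices $u_0=v_0,u_1,v_1,\ldots,u_{r-1},v_{r-1},u_r=v_r$ and edges $(u_i,u_{i+1}),(v_i,v_{i+1})$ for $0\le i\le r-1$. A degenerate $\Gamma_r$ in $X$ is the image of a map $\Gamma_r\to X$. The pair $(X,Y)$ is $r$-separable ($r<\infty$) if any degenerate $\Gamma_r$ in $X\cup Y$ is subdivided into degenerate $\Gamma_r$'s, each of which is in either $X$ or $Y$ (no subdivision is needed if it already lies in $X$ or $Y$). *)

theory Defs
  imports
    "HOL-Algebra.Free_Abelian_Groups"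
    "HOL-Library.Extended_Nat"
    "Graph_Theory.Pair_Digraph"
begin

section \<open>Directed graphs\<close>

text \<open>
  A directed graph is a value \<open>X\<close> of the record type \<open>'a pair_pre_digraph\<close> satisfying
  \<open>pair_loopfree_digraph X\<close>: edges are ordered pairs of distinct vertices. The graph may be
  empty or infinite.
\<close>

definition digraph_union ::
    "'a pair_pre_digraph \<Rightarrow> 'a pair_pre_digraph \<Rightarrow> 'a pair_pre_digraph" (infixl \<open>\<union>\<^sub>G\<close> 65) where
  "X \<union>\<^sub>G Y = \<lparr>pverts = pverts X \<union> pverts Y, parcs = parcs X \<union> parcs Y\<rparr>"

definition digraph_inter ::
    "'a pair_pre_digraph \<Rightarrow> 'a pair_pre_digraph \<Rightarrow> 'a pair_pre_digraph" (infixl \<open>\<inter>\<^sub>G\<close> 70) where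
  "X \<inter>\<^sub>G Y = \<lparr>pverts = pverts X \<inter> pverts Y, parcs = parcs X \<inter> parcs Y\<rparr>"

text \<open>The smallest subgraph whose union with the subgraph \<open>A\<close> is \<open>X\<close>.\<close>

definition digraph_diff ::
    "'a pair_pre_digraph \<Rightarrow> 'a pair_pre_digraph \<Rightarrow> 'a pair_pre_digraph" (infixl \<open>-\<^sub>G\<close> 65) where
  "X -\<^sub>G A =
    \<lparr>pverts = (pverts X - pverts A) \<union> fst ` (parcs X - parcs A) \<union> snd ` (parcs X - parcs A),
     parcs = parcs X - parcs A\<rparr>"

definition digraph_induced :: "'a pair_pre_digraph \<Rightarrow> 'a set \<Rightarrow> 'a pair_pre_digraph" where
  "digraph_induced X S = \<lparr>pverts = pverts X \<inter> S, parcs = parcs X \<inter> S \<times> S\<rparr>"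

text \<open>Unlike the notion of the graph library, this one counts the empty graph as connected.\<close>

definition zigzag_connected :: "'a pair_pre_digraph \<Rightarrow> bool" where
  "zigzag_connected X \<longleftrightarrow>
    (\<forall>x \<in> pverts X. \<forall>y \<in> pverts X. (x, y) \<in> (parcs X \<union> (parcs X)\<inverse>)\<^sup>*)"

definition digraph_map :: "'a pair_pre_digraph \<Rightarrow> 'b pair_pre_digraph \<Rightarrow> ('a \<Rightarrow> 'b) \<Rightarrow> bool" where
  "digraph_map X Y f \<longleftrightarrow>
    (\<forall>x \<in> pverts X. f x \<in> pverts Y) \<and>
    (\<forall>(x, y) \<in> parcs X. (f x, f y) \<in> parcs Y \<or> f x = f y)"

definition digraph_hom :: "'a pair_pre_digraph \<Rightarrow> 'b pair_pre_digraph \<Rightarrow> ('a \<Rightarrow> 'b) \<Rightarrow> bool" where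
  "digraph_hom X Y f \<longleftrightarrow>
    (\<forall>x \<in> pverts X. f x \<in> pverts Y) \<and> (\<forall>(x, y) \<in> parcs X. (f x, f y) \<in> parcs Y)"

definition digraph_image :: "'a pair_pre_digraph \<Rightarrow> ('a \<Rightarrow> 'b) \<Rightarrow> 'b pair_pre_digraph" where
  "digraph_image X f =
    \<lparr>pverts = f ` pverts X, parcs = {(f x, f y) |x y. (x, y) \<in> parcs X \<and> f x \<noteq> f y}\<rparr>"


section \<open>The magnitude-path spectral sequence\<close>

definition digraph_dist :: "'a pair_pre_digraph \<Rightarrow> 'a \<Rightarrow> 'a \<Rightarrow> enat" where
  "digraph_dist X x y = (INF w \<in> {w. pre_digraph.awalk (with_proj X) x w y}. enat (length w))"

definition tuple_length :: "'a pair_pre_digraph \<Rightarrow> 'a list \<Rightarrow> enat" where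
  "tuple_length X xs = (\<Sum>i < length xs - 1. digraph_dist X (xs ! i) (xs ! Suc i))"

text \<open>
  Tuples \<open>(x\<^sub>0, \<dots>, x\<^sub>n)\<close> are lists of length \<open>n + 1\<close>. All degrees are integers, and the chain
  groups vanish in negative degrees; in particular the empty list is not a generator in
  degree \<open>-1\<close>.
\<close>

definition RC_gens :: "'a pair_pre_digraph \<Rightarrow> int \<Rightarrow> 'a list set" where
  "RC_gens X n = {xs. xs \<noteq> [] \<and> int (length xs) = n + 1 \<and> set xs \<subseteq> pverts X \<and>
    distinct_adj xs \<and> tuple_length X xs < \<infinity>}"

definition RC :: "'a pair_pre_digraph \<Rightarrow> int \<Rightarrow> ('a list \<Rightarrow>\<^sub>0 int) monoid" where
  "RC X n = free_Abelian_group (RC_gens X n)"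

definition F_RC :: "'a pair_pre_digraph \<Rightarrow> int \<Rightarrow> int \<Rightarrow> ('a list \<Rightarrow>\<^sub>0 int) monoid" where
  "F_RC X p n =
    free_Abelian_group {xs \<in> RC_gens X n. \<exists>l. tuple_length X xs = enat l \<and> int l \<le> p}"

text \<open>
  The chain of a tuple: zero for tuples with two equal consecutive entries. Mapping the empty
  tuple to zero makes the boundary of a tuple \<open>(x\<^sub>0)\<close> vanish.
\<close>

definition tuple_chain :: "'a list \<Rightarrow> 'a list \<Rightarrow>\<^sub>0 int" where
  "tuple_chain xs = (if xs \<noteq> [] \<and> distinct_adj xs then frag_of xs else 0)"

definition RC_boundary :: "('a list \<Rightarrow>\<^sub>0 int) \<Rightarrow> ('a list \<Rightarrow>\<^sub>0 int)" where
  "RC_boundary = frag_extend (\<lambda>xs.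
    \<Sum>i < length xs. frag_cmul ((-1) ^ i) (tuple_chain (take i xs @ drop (Suc i) xs)))"

definition RC_map :: "('a \<Rightarrow> 'b) \<Rightarrow> ('a list \<Rightarrow>\<^sub>0 int) \<Rightarrow> ('b list \<Rightarrow>\<^sub>0 int)" where
  "RC_map f = frag_extend (\<lambda>xs. tuple_chain (map f xs))"

definition MPSS_Z ::
    "'a pair_pre_digraph \<Rightarrow> int \<Rightarrow> int \<Rightarrow> int \<Rightarrow> ('a list \<Rightarrow>\<^sub>0 int) set" where
  "MPSS_Z X r p q =
    {c \<in> carrier (F_RC X p (p + q)). RC_boundary c \<in> carrier (F_RC X (p - r) (p + q - 1))}"

definition MPSS_B ::
    "'a pair_pre_digraph \<Rightarrow> int \<Rightarrow> int \<Rightarrow> int \<Rightarrow> ('a list \<Rightarrow>\<^sub>0 int) set" where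
  "MPSS_B X r p q =
    MPSS_Z X (r - 1) (p - 1) (q + 1)
      <#>\<^bsub>RC X (p + q)\<^esub> RC_boundary ` MPSS_Z X (r - 1) (p + r - 1) (q - r + 2)"

definition MPSS_E ::
    "'a pair_pre_digraph \<Rightarrow> int \<Rightarrow> int \<Rightarrow> int \<Rightarrow> ('a list \<Rightarrow>\<^sub>0 int) set monoid" where
  "MPSS_E X r p q = (RC X (p + q))\<lparr>carrier := MPSS_Z X r p q\<rparr> Mod MPSS_B X r p q"

text \<open>
  The homomorphism from the page of \<open>X\<close> to the page of \<open>Y\<close> induced by a map \<open>f\<close> from \<open>X\<close>
  to \<open>Y\<close>: the common coset of the images of all representatives.
\<close>

definition MPSS_map :: "('a \<Rightarrow> 'b) \<Rightarrow> 'b pair_pre_digraph \<Rightarrow> int \<Rightarrow> int \<Rightarrow> int \<Rightarrow>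
    ('a list \<Rightarrow>\<^sub>0 int) set \<Rightarrow> ('b list \<Rightarrow>\<^sub>0 int) set" where
  "MPSS_map f Y r p q C =
    the_elem ((\<lambda>c. MPSS_B Y r p q #>\<^bsub>RC Y (p + q)\<^esub> RC_map f c) ` C)"


section \<open>Subdivision and separability\<close>

definition path_graphs :: "nat \<Rightarrow> nat pair_pre_digraph set" where
  "path_graphs n = {I. pverts I = {0..n} \<and>
    parcs I \<subseteq> (\<Union>i < n. {(i, Suc i), (Suc i, i)}) \<and>
    (\<forall>i < n. (i, Suc i) \<in> parcs I \<longleftrightarrow> (Suc i, i) \<notin> parcs I)}"

definition reduced_loop ::
    "'a pair_pre_digraph \<Rightarrow> nat \<Rightarrow> nat pair_pre_digraph \<Rightarrow> (nat \<Rightarrow> 'a) \<Rightarrow> bool" where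
  "reduced_loop X n I f \<longleftrightarrow> I \<in> path_graphs n \<and> digraph_hom I X f \<and> f 0 = f n"

text \<open>The image of a reduced loop in \<open>X\<close> is automatically a subgraph of \<open>X\<close>.\<close>

definition loop_represented :: "'a pair_pre_digraph \<Rightarrow> 'a pair_pre_digraph \<Rightarrow> bool" where
  "loop_represented X L \<longleftrightarrow> (\<exists>n I f. reduced_loop X n I f \<and> digraph_image I f = L)"

text \<open>\<open>A\<close> is represented by a subpath of some reduced loop in \<open>X\<close> that represents \<open>L\<close>.\<close>

definition subpath_represented ::
    "'a pair_pre_digraph \<Rightarrow> 'a pair_pre_digraph \<Rightarrow> 'a pair_pre_digraph \<Rightarrow> bool" where
  "subpath_represented X L A \<longleftrightarrow>
    (\<exists>n I f k l. reduced_loop X n I f \<and> digraph_image I f = L \<and>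
      k \<le> l \<and> l \<le> n \<and> digraph_image (digraph_induced I {k..l}) f = A)"

definition subdivision2 :: "'a pair_pre_digraph \<Rightarrow> 'a pair_pre_digraph \<Rightarrow>
    'a pair_pre_digraph \<Rightarrow> 'a pair_pre_digraph \<Rightarrow> bool" where
  "subdivision2 X L L1 L2 \<longleftrightarrow>
    loop_represented X L \<and> loop_represented X L1 \<and> loop_represented X L2 \<and>
    subpath_represented X L1 (L1 \<inter>\<^sub>G L2) \<and> subpath_represented X L2 (L1 \<inter>\<^sub>G L2) \<and>
    L = (L1 \<union>\<^sub>G L2) -\<^sub>G (L1 \<inter>\<^sub>G L2)"

inductive subdivision ::
    "'a pair_pre_digraph \<Rightarrow> 'a pair_pre_digraph \<Rightarrow> 'a pair_pre_digraph list \<Rightarrow> bool"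
  for X where
  none: "loop_represented X L \<Longrightarrow> subdivision X L [L]"
| split: "subdivision2 X L L1 L2 \<Longrightarrow> subdivision X L1 Ls1 \<Longrightarrow> subdivision X L2 Ls2 \<Longrightarrow>
    subdivision X L (Ls1 @ Ls2)"

text \<open>
  The vertex \<open>u\<^sub>i\<close> is \<open>(i, False)\<close>, and \<open>v\<^sub>i\<close> is \<open>(i, True)\<close> except that \<open>v\<^sub>0 = u\<^sub>0\<close>
  and \<open>v\<^sub>r = u\<^sub>r\<close>.
\<close>

definition Gamma_u :: "nat \<Rightarrow> nat \<times> bool" where
  "Gamma_u i = (i, False)"

definition Gamma_v :: "nat \<Rightarrow> nat \<Rightarrow> nat \<times> bool" where
  "Gamma_v r i = (i, 0 < i \<and> i < r)"

definition Gamma :: "nat \<Rightarrow> (nat \<times> bool) pair_pre_digraph" where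
  "Gamma r = \<lparr>pverts = Gamma_u ` {0..r} \<union> Gamma_v r ` {0..r},
    parcs = (\<Union>i < r. {(Gamma_u i, Gamma_u (Suc i)), (Gamma_v r i, Gamma_v r (Suc i))})\<rparr>"

definition degenerate_Gamma :: "nat \<Rightarrow> 'a pair_pre_digraph \<Rightarrow> 'a pair_pre_digraph \<Rightarrow> bool" where
  "degenerate_Gamma r X L \<longleftrightarrow> (\<exists>g. digraph_map (Gamma r) X g \<and> digraph_image (Gamma r) g = L)"

definition separable :: "nat \<Rightarrow> 'a pair_pre_digraph \<Rightarrow> 'a pair_pre_digraph \<Rightarrow> bool" where
  "separable r X Y \<longleftrightarrow>
    (\<forall>L. degenerate_Gamma r (X \<union>\<^sub>G Y) L \<longrightarrow>
      (\<exists>Ls. subdivision (X \<union>\<^sub>G Y) L Ls \<and>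
        (\<forall>M \<in> set Ls. degenerate_Gamma r X M \<or> degenerate_Gamma r Y M)))"


section \<open>Exactness\<close>

text \<open>
  Exactness of \<open>G \<rightarrow> H \<rightarrow> K \<rightarrow> 0\<close>. The library predicate \<open>exact_seq\<close> requires all groups of the
  sequence to have elements of the same type.
\<close>

definition right_exact :: "('a, 'i) monoid_scheme \<Rightarrow> ('b, 'j) monoid_scheme \<Rightarrow>
    ('c, 'k) monoid_scheme \<Rightarrow> ('a \<Rightarrow> 'b) \<Rightarrow> ('b \<Rightarrow> 'c) \<Rightarrow> bool" where
  "right_exact G H K \<phi> \<psi> \<longleftrightarrow> group_hom G H \<phi> \<and> group_hom H K \<psi> \<and>
    kernel H K \<psi> = \<phi> ` carrier G \<and> \<psi> ` carrier H = carrier K"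

end

theory Submission
  imports Defs
begin

text \<open>
  In bidegree \<open>(1, 0)\<close> the page of a graph \<open>X\<close> is a quotient \<open>Z(X) / B(X)\<close>. As \<open>r \<ge> 2\<close>, the group
  \<open>Z(X)\<close> consists of the integral cycles on the edges of \<open>X\<close>, and \<open>B(X)\<close> consists of the boundaries
  of triples of length at most \<open>r\<close> that are supported on edges. The subgroup \<open>B(X)\<close> is generated by
  the differences of two directed walks of length at most \<open>r\<close> with common endpoints: coning off a
  walk from its starting point shows that these differences are boundaries
  (\<open>bigon_in_short_boundaries\<close>), and replacing pairs of vertices by shortest walks shows that
  there are no others (\<open>short_boundaries_least\<close>).

  Right exactness for the quotients follows by a diagram chase (\<open>right_exact_quotients\<close>) from
  \<open>Z(X \<inter> Y) = Z(X) \<inter> Z(Y)\<close>, \<open>Z(X \<union> Y) = Z(X) + Z(Y)\<close> and \<open>B(X \<union> Y) = B(X) + B(Y)\<close>. The first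
  equation is immediate. The second is the Mayer-Vietoris argument for a connected
  intersection (\<open>edge_cycles_split\<close>).

  For the third equation consider the difference of two short walks in \<open>X \<union> Y\<close>. It is a cycle on a
  degenerate \<open>\<Gamma>\<^sub>r\<close>, which by separability is subdivided into degenerate \<open>\<Gamma>\<^sub>r\<close>'s in \<open>X\<close> or \<open>Y\<close>.
  A subdivision is only a statement about subgraphs and does not record how the loops run through
  them. It suffices nevertheless, for two reasons. When \<open>L\<close> is subdivided into \<open>L1\<close> and \<open>L2\<close>, the
  intersection of \<open>L1\<close> and \<open>L2\<close> is connected, so by the Mayer-Vietoris argument every cycle on \<open>L\<close>
  is a sum of cycles on \<open>L1\<close> and \<open>L2\<close> (\<open>subdivision_cycles\<close>). And on a degenerate \<open>\<Gamma>\<^sub>r\<close> in \<open>X\<close> every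
  cycle, not just the image of the defining loop, lies in \<open>B(X)\<close> (\<open>degenerate_Gamma_cycles\<close>): each
  of its edges is the end of a walk of length at most \<open>r\<close> from the common starting point.
\<close>

section \<open>Subgroups of free abelian groups\<close>

abbreviation chain_subgroup :: "('b \<Rightarrow>\<^sub>0 int) set \<Rightarrow> bool" where
  "chain_subgroup H \<equiv> subgroup H (free_Abelian_group UNIV)"

lemma chain_subgroup_zero: "chain_subgroup H \<Longrightarrow> 0 \<in> H"
  using subgroup.one_closed by fastforce

lemma chain_subgroup_add: "chain_subgroup H \<Longrightarrow> a \<in> H \<Longrightarrow> b \<in> H \<Longrightarrow> a + b \<in> H"
  using subgroup.m_closed by fastforce

lemma chain_subgroup_minus: "chain_subgroup H \<Longrightarrow> a \<in> H \<Longrightarrow> - a \<in> H"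
  using subgroup.m_inv_closed by fastforce

lemma chain_subgroup_diff: "chain_subgroup H \<Longrightarrow> a \<in> H \<Longrightarrow> b \<in> H \<Longrightarrow> a - b \<in> H"
  using chain_subgroup_add[of H a "- b"] chain_subgroup_minus by auto

lemma chain_subgroupI:
  assumes "0 \<in> H" and "\<And>a b. a \<in> H \<Longrightarrow> b \<in> H \<Longrightarrow> a - b \<in> H"
  shows "chain_subgroup H"
proof (rule group.subgroupI)
  have "- b \<in> H" if "b \<in> H" for b using assms(2)[OF assms(1) that] by simp
  then show "inv\<^bsub>free_Abelian_group UNIV\<^esub> a \<in> H" if "a \<in> H" for a using that by simp
  then show "a \<otimes>\<^bsub>free_Abelian_group UNIV\<^esub> b \<in> H" if "a \<in> H" "b \<in> H" for a b
    using assms(2)[of a "- b"] that by simp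
qed (use assms(1) in auto)

section \<open>Edge chains\<close>

definition edge_tuples :: "('a \<times> 'a) set \<Rightarrow> 'a list set" where
  "edge_tuples E = (\<lambda>(x, y). [x, y]) ` E"

definition edge_cycles :: "('a \<times> 'a) set \<Rightarrow> ('a list \<Rightarrow>\<^sub>0 int) set" where
  "edge_cycles E = {c. Poly_Mapping.keys c \<subseteq> edge_tuples E \<and> RC_boundary c = 0}"

definition arc_chain :: "('a \<times> 'a) list \<Rightarrow> ('a list \<Rightarrow>\<^sub>0 int)" where
  "arc_chain w = (\<Sum>(x, y)\<leftarrow>w. frag_of [x, y])"

lemma arc_chain_Nil [simp]: "arc_chain [] = 0"
  and arc_chain_Cons [simp]: "arc_chain ((x, y) # w) = frag_of [x, y] + arc_chain w"
  and arc_chain_append [simp]: "arc_chain (w @ w') = arc_chain w + arc_chain w'"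
  by (simp_all add: arc_chain_def)

lemma RC_boundary_diff: "RC_boundary (a - b) = RC_boundary a - RC_boundary b"
  and RC_boundary_add: "RC_boundary (a + b) = RC_boundary a + RC_boundary b"
  and RC_boundary_zero [simp]: "RC_boundary 0 = 0"
  by (simp_all add: RC_boundary_def frag_extend_diff frag_extend_add)

lemma RC_boundary_edge [simp]: "RC_boundary (frag_of [x, y]) = frag_of [y] - frag_of [x]"
  by (simp add: RC_boundary_def tuple_chain_def numeral_2_eq_2)

text \<open>
  Degenerate triples are included: if two consecutive entries agree, the left side vanishes and the
  three terms on the right cancel.
\<close>

lemma RC_boundary_triple:
  "RC_boundary (tuple_chain [x, y, z]) = tuple_chain [y, z] - tuple_chain [x, z] + tuple_chain [x, y]"
proof (cases "x \<noteq> y \<and> y \<noteq> z")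
  case True
  have "RC_boundary (frag_of [x, y, z]) = tuple_chain [y, z] - tuple_chain [x, z] + tuple_chain [x, y]"
    by (simp add: RC_boundary_def lessThan_Suc)
  with True show ?thesis by (simp add: tuple_chain_def)
qed (auto simp: tuple_chain_def)

lemma keys_tuple_chain: "Poly_Mapping.keys (tuple_chain xs) \<subseteq> {xs}"
  by (simp add: tuple_chain_def)

lemma keys_add_subset:
  "Poly_Mapping.keys a \<subseteq> S \<Longrightarrow> Poly_Mapping.keys b \<subseteq> S \<Longrightarrow>
    Poly_Mapping.keys (a + b) \<subseteq> S"
  using keys_add[of a b] by blast

lemma keys_diff_subset:
  "Poly_Mapping.keys a \<subseteq> S \<Longrightarrow> Poly_Mapping.keys b \<subseteq> S \<Longrightarrow>
    Poly_Mapping.keys (a - b) \<subseteq> S"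
  using keys_diff[of a b] by blast

lemma keys_arc_chain: "Poly_Mapping.keys (arc_chain w) \<subseteq> edge_tuples (set w)"
proof (induction w)
  case (Cons e w)
  then show ?case
    using keys_add[of "frag_of [fst e, snd e]" "arc_chain w"]
    by (cases e) (auto simp: edge_tuples_def)
qed simp

lemma edge_tuples_mono: "E \<subseteq> E' \<Longrightarrow> edge_tuples E \<subseteq> edge_tuples E'"
  by (auto simp: edge_tuples_def)

lemma edge_cycles_mono: "E \<subseteq> E' \<Longrightarrow> edge_cycles E \<subseteq> edge_cycles E'"
  unfolding edge_cycles_def using edge_tuples_mono by blast

lemma edge_cycles_Int: "edge_cycles (E \<inter> E') = edge_cycles E \<inter> edge_cycles E'"
proof -
  have "edge_tuples (E \<inter> E') = edge_tuples E \<inter> edge_tuples E'"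
    by (auto simp: edge_tuples_def)
  then show ?thesis by (auto simp: edge_cycles_def)
qed

lemma chain_subgroup_edge_cycles: "chain_subgroup (edge_cycles E)"
  by (rule chain_subgroupI)
     (simp_all add: edge_cycles_def RC_boundary_diff keys_diff_subset)

section \<open>Splitting cycles over a union of graphs\<close>

text \<open>
  Reduced homology in degree zero vanishes: every vertex is joined by a zig-zag to a base vertex,
  and the signed edges of the zig-zag bound the difference of the two. The sum of the coefficients
  is written as a chain on a one-point set, so that it is a \<open>frag_extend\<close> like the boundary itself.
\<close>

lemma connected_fill:
  assumes conn: "zigzag_connected A"
    and z: "Poly_Mapping.keys z \<subseteq> (\<lambda>v. [v]) ` pverts A"
    and aug: "frag_extend (\<lambda>_. frag_of ()) z = 0"
  obtains e where "Poly_Mapping.keys e \<subseteq> edge_tuples (parcs A)" "RC_boundary e = z"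
proof (cases "pverts A = {}")
  \<comment> \<open>The empty graph counts as connected but has no base vertex; only the zero chain lives on it.\<close>
  case True
  then show ?thesis using z that[of 0] by simp
next
  case False
  then obtain v0 where v0: "v0 \<in> pverts A" by blast
  let ?P = "\<lambda>z. \<exists>e. Poly_Mapping.keys e \<subseteq> edge_tuples (parcs A) \<and>
    RC_boundary e = z - frag_extend (\<lambda>_. frag_of [v0]) z"
  have "?P z"
    using z
  proof (induction rule: frag_induction)
    case zero
    show ?case by (rule exI[of _ 0]) simp
  next
    case (one xs)
    then obtain v where v: "v \<in> pverts A" "xs = [v]" by blast
    from conn v0 v(1) have "(v0, v) \<in> (parcs A \<union> (parcs A)\<inverse>)\<^sup>*"
      by (simp add: zigzag_connected_def)
    then have "?P (frag_of [v])"
    proof induction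
      case base
      show ?case by (rule exI[of _ 0]) simp
    next
      case (step y w)
      then obtain e where e: "Poly_Mapping.keys e \<subseteq> edge_tuples (parcs A)"
        "RC_boundary e = frag_of [y] - frag_of [v0]" by auto
      from step(2) show ?case
      proof
        assume yw: "(y, w) \<in> parcs A"
        have "Poly_Mapping.keys (e + frag_of [y, w]) \<subseteq> edge_tuples (parcs A)"
          by (rule keys_add_subset[OF e(1)]) (use yw in \<open>force simp: edge_tuples_def\<close>)
        moreover have "RC_boundary (e + frag_of [y, w]) = frag_of [w] - frag_of [v0]"
          by (simp add: RC_boundary_add e(2))
        ultimately show ?thesis by auto
      next
        assume yw: "(y, w) \<in> (parcs A)\<inverse>"
        have "Poly_Mapping.keys (e - frag_of [w, y]) \<subseteq> edge_tuples (parcs A)"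
          by (rule keys_diff_subset[OF e(1)]) (use yw in \<open>force simp: edge_tuples_def\<close>)
        moreover have "RC_boundary (e - frag_of [w, y]) = frag_of [w] - frag_of [v0]"
          by (simp add: RC_boundary_diff e(2))
        ultimately show ?thesis by auto
      qed
    qed
    with v show ?case by simp
  next
    case (diff a b)
    then obtain e e' where e: "Poly_Mapping.keys e \<subseteq> edge_tuples (parcs A)"
      "RC_boundary e = a - frag_extend (\<lambda>_. frag_of [v0]) a"
      and e': "Poly_Mapping.keys e' \<subseteq> edge_tuples (parcs A)"
      "RC_boundary e' = b - frag_extend (\<lambda>_. frag_of [v0]) b" by blast
    have "RC_boundary (e - e') = (a - b) - frag_extend (\<lambda>_. frag_of [v0]) (a - b)"
      unfolding RC_boundary_diff frag_extend_diff e(2) e'(2) by simp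
    with keys_diff_subset[OF e(1) e'(1)] show ?case by blast
  qed
  moreover have "frag_extend (\<lambda>_. frag_of [v0]) z
      = frag_extend (\<lambda>_. frag_of [v0]) (frag_extend (\<lambda>_. frag_of ()) z)"
    using frag_extend_compose[of "\<lambda>_. frag_of [v0]" "\<lambda>_. ()" z] by (simp add: comp_def)
  ultimately show ?thesis using aug that by auto
qed

lemma augmentation_boundary:
  assumes "Poly_Mapping.keys c \<subseteq> edge_tuples E"
  shows "frag_extend (\<lambda>_. frag_of ()) (RC_boundary c) = 0"
  using assms
  by (induction rule: frag_induction)
     (auto simp: edge_tuples_def RC_boundary_diff frag_extend_diff)

lemma keys_boundary_edges:
  assumes wf: "pair_wf_digraph A" and c: "Poly_Mapping.keys c \<subseteq> edge_tuples (parcs A)"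
  shows "Poly_Mapping.keys (RC_boundary c) \<subseteq> (\<lambda>v. [v]) ` pverts A"
  using c
proof (induction rule: frag_induction)
  case (one xs)
  then obtain x y where "(x, y) \<in> parcs A" "xs = [x, y]" by (auto simp: edge_tuples_def)
  with wf have "x \<in> pverts A" "y \<in> pverts A" by (auto dest: pair_wf_digraph.wellformed')
  then have "Poly_Mapping.keys (frag_of [y] - frag_of [x]) \<subseteq> (\<lambda>v. [v]) ` pverts A"
    by (intro keys_diff_subset) auto
  with \<open>xs = [x, y]\<close> show ?case by simp
next
  case (diff a b)
  then show ?case unfolding RC_boundary_diff by (rule keys_diff_subset)
qed simp

text \<open>
  The Mayer-Vietoris argument: cut the cycle into an edge chain of \<open>A\<close> and one of \<open>B\<close>. Their
  boundaries cancel, so they live on the common vertices and have coefficient sum zero, and an edge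
  chain of the connected intersection moves one boundary into the other part.
\<close>

lemma edge_cycles_split:
  assumes wfA: "pair_wf_digraph A" and wfB: "pair_wf_digraph B"
    and conn: "zigzag_connected (A \<inter>\<^sub>G B)"
    and c: "c \<in> edge_cycles (parcs A \<union> parcs B)"
  obtains a b where "a \<in> edge_cycles (parcs A)" "b \<in> edge_cycles (parcs B)" "c = a + b"
proof -
  have "edge_tuples (parcs A \<union> parcs B) = edge_tuples (parcs A) \<union> edge_tuples (parcs B)"
    by (auto simp: edge_tuples_def)
  with c obtain a b where a: "Poly_Mapping.keys a \<subseteq> edge_tuples (parcs A)"
    and b: "Poly_Mapping.keys b \<subseteq> edge_tuples (parcs B)" and ab: "a + b = c"
    by (metis (no_types, lifting) edge_cycles_def frag_split mem_Collect_eq)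
  have ab0: "RC_boundary a + RC_boundary b = 0"
    using c ab by (auto simp: edge_cycles_def RC_boundary_add)
  then have eq: "RC_boundary b = - RC_boundary a" by (simp add: eq_neg_iff_add_eq_0 add.commute)
  have "Poly_Mapping.keys (RC_boundary a) \<subseteq> (\<lambda>v. [v]) ` pverts A"
    by (rule keys_boundary_edges[OF wfA a])
  moreover have "Poly_Mapping.keys (RC_boundary a) \<subseteq> (\<lambda>v. [v]) ` pverts B"
    using keys_boundary_edges[OF wfB b] unfolding eq keys_minus .
  ultimately have "Poly_Mapping.keys (RC_boundary a) \<subseteq> (\<lambda>v. [v]) ` pverts (A \<inter>\<^sub>G B)"
    by (auto simp: digraph_inter_def)
  then obtain e where e: "Poly_Mapping.keys e \<subseteq> edge_tuples (parcs (A \<inter>\<^sub>G B))"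
    and be: "RC_boundary e = RC_boundary a"
    by (rule connected_fill[OF conn _ augmentation_boundary[OF a]])
  have eA: "Poly_Mapping.keys e \<subseteq> edge_tuples (parcs A)"
    and eB: "Poly_Mapping.keys e \<subseteq> edge_tuples (parcs B)"
    using e by (auto simp: digraph_inter_def edge_tuples_def)
  show ?thesis
  proof
    show "a - e \<in> edge_cycles (parcs A)"
      using a eA be by (simp add: edge_cycles_def RC_boundary_diff keys_diff_subset)
    show "b + e \<in> edge_cycles (parcs B)"
      using b eB be eq by (simp add: edge_cycles_def RC_boundary_add keys_add_subset)
    show "c = a - e + (b + e)" using ab by simp
  qed
qed

section \<open>Subdivisions of loops\<close>

lemma digraph_image_arc:
  "(a, b) \<in> parcs I \<Longrightarrow> f a \<noteq> f b \<Longrightarrow> (f a, f b) \<in> parcs (digraph_image I f)"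
  by (auto simp: digraph_image_def)

lemma loop_represented_wf: "loop_represented X L \<Longrightarrow> pair_wf_digraph L"
proof
  fix e assume "loop_represented X L" "e \<in> parcs L"
  then obtain n I f where I: "I \<in> path_graphs n" and L: "digraph_image I f = L"
    by (auto simp: loop_represented_def reduced_loop_def)
  have "x \<in> pverts I \<and> y \<in> pverts I" if "(x, y) \<in> parcs I" for x y
    using that I by (auto simp: path_graphs_def)
  with \<open>e \<in> parcs L\<close> L show "fst e \<in> pverts L" "snd e \<in> pverts L"
    by (auto simp: digraph_image_def)
qed

lemma subpath_represented_connected:
  assumes "subpath_represented X L A"
  shows "zigzag_connected A"
proof -
  from assms obtain n I f k l where I: "I \<in> path_graphs n" and kl: "k \<le> l" "l \<le> n"
    and A: "A = digraph_image (digraph_induced I {k..l}) f"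
    by (auto simp: subpath_represented_def reduced_loop_def)
  have V: "pverts A = f ` {k..l}"
    using I kl by (auto simp: A digraph_image_def digraph_induced_def path_graphs_def)
  let ?R = "parcs A \<union> (parcs A)\<inverse>"
  have sym: "sym ?R" by (auto simp: sym_def)
  have step_path: "(f i, f (Suc i)) \<in> ?R\<^sup>*" if "k \<le> i" "Suc i \<le> l" for i
  proof (cases "f i = f (Suc i)")
    case False
    have "(i, Suc i) \<in> parcs I \<or> (Suc i, i) \<in> parcs I"
      using I that kl by (auto simp: path_graphs_def)
    moreover have "(f a, f b) \<in> parcs A"
      if "(a, b) \<in> parcs I" "f a \<noteq> f b" "a \<in> {k..l}" "b \<in> {k..l}" for a b
      unfolding A by (rule digraph_image_arc) (use that in \<open>auto simp: digraph_induced_def\<close>)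
    ultimately have "(f i, f (Suc i)) \<in> ?R"
      using False that by fastforce
    then show ?thesis by blast
  qed simp
  have reach: "(f k, f i) \<in> ?R\<^sup>*" if "k \<le> i" "i \<le> l" for i
    using that
  proof (induction i rule: dec_induct)
    case (step i)
    then show ?case using step_path[of i] by (meson Suc_leD rtrancl_trans)
  qed simp
  show ?thesis
    unfolding zigzag_connected_def V
  proof (intro ballI)
    fix x y assume "x \<in> f ` {k..l}" "y \<in> f ` {k..l}"
    then have "(f k, x) \<in> ?R\<^sup>*" "(f k, y) \<in> ?R\<^sup>*" using reach by auto
    then show "(x, y) \<in> ?R\<^sup>*" by (meson rtrancl_trans symD sym_rtrancl sym)
  qed
qed

text \<open>
  The symmetric difference of \<open>L1\<close> and \<open>L2\<close> has its edges in their union, and \<open>L1\<close> and \<open>L2\<close> meet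
  in the connected image of a path; hence a cycle on \<open>L\<close> is a sum of cycles on the two parts. The
  statement covers all cycles on the subgraph, since the subdivision only sees the image of a loop
  and forgets how often the loop passes through each edge.
\<close>

lemma subdivision_cycles:
  assumes "subdivision X L Ls" and H: "chain_subgroup H"
    and "\<And>M. M \<in> set Ls \<Longrightarrow> edge_cycles (parcs M) \<subseteq> H"
  shows "edge_cycles (parcs L) \<subseteq> H"
  using assms(1,3)
proof induction
  case (split L L1 L2 Ls1 Ls2)
  have conn: "zigzag_connected (L1 \<inter>\<^sub>G L2)" and wf: "pair_wf_digraph L1" "pair_wf_digraph L2"
    and L: "parcs L \<subseteq> parcs L1 \<union> parcs L2"
    using split(1) loop_represented_wf subpath_represented_connected
    by (auto simp: subdivision2_def digraph_diff_def digraph_union_def)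
  show ?case
  proof
    fix c assume "c \<in> edge_cycles (parcs L)"
    then have "c \<in> edge_cycles (parcs L1 \<union> parcs L2)" using edge_cycles_mono[OF L] by blast
    then obtain a b where "a \<in> edge_cycles (parcs L1)" "b \<in> edge_cycles (parcs L2)" "c = a + b"
      using edge_cycles_split[OF wf conn] by blast
    moreover have "edge_cycles (parcs L1) \<subseteq> H" "edge_cycles (parcs L2) \<subseteq> H"
      using split by auto
    ultimately show "c \<in> H" using chain_subgroup_add[OF H] by blast
  qed
qed simp

section \<open>Boundaries of short triples\<close>

definition short_triples :: "nat \<Rightarrow> 'a pair_pre_digraph \<Rightarrow> 'a list set" where
  "short_triples r G = {[x, y, z] |x y z. {x, y, z} \<subseteq> pverts G \<and> x \<noteq> y \<and> y \<noteq> z \<and>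
    digraph_dist G x y + digraph_dist G y z \<le> enat r}"

text \<open>
  For \<open>2 \<le> r\<close> this is the subgroup by which the edge cycles are divided in bidegree \<open>(1, 0)\<close> of
  page \<open>r\<close>.
\<close>

definition short_boundaries :: "nat \<Rightarrow> 'a pair_pre_digraph \<Rightarrow> ('a list \<Rightarrow>\<^sub>0 int) set" where
  "short_boundaries r G = RC_boundary ` {t. Poly_Mapping.keys t \<subseteq> short_triples r G \<and>
    Poly_Mapping.keys (RC_boundary t) \<subseteq> edge_tuples (parcs G)}"

lemma chain_subgroup_short_boundaries: "chain_subgroup (short_boundaries r G)"
proof (rule chain_subgroupI)
  show "0 \<in> short_boundaries r G"
    unfolding short_boundaries_def by (rule image_eqI[of _ _ 0]) auto
  fix a b assume "a \<in> short_boundaries r G" "b \<in> short_boundaries r G"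
  then obtain s t where "a = RC_boundary s" "b = RC_boundary t"
    "Poly_Mapping.keys s \<subseteq> short_triples r G" "Poly_Mapping.keys t \<subseteq> short_triples r G"
    "Poly_Mapping.keys (RC_boundary s) \<subseteq> edge_tuples (parcs G)"
    "Poly_Mapping.keys (RC_boundary t) \<subseteq> edge_tuples (parcs G)"
    by (auto simp: short_boundaries_def)
  then show "a - b \<in> short_boundaries r G"
    unfolding short_boundaries_def
    by (intro image_eqI[of _ _ "s - t"]) (simp_all add: RC_boundary_diff keys_diff_subset)
qed

lemma boundary_frag_extend_diff:
  "frag_extend f (RC_boundary (a - b))
    = frag_extend f (RC_boundary a) - frag_extend f (RC_boundary b)"
  by (simp add: RC_boundary_diff frag_extend_diff)

context pair_wf_digraph
begin

lemma digraph_dist_le_iff: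
  "digraph_dist G x y \<le> enat n \<longleftrightarrow> (\<exists>w. awalk x w y \<and> length w \<le> n)"
proof
  assume le: "digraph_dist G x y \<le> enat n"
  let ?S = "(\<lambda>w. enat (length w)) ` {w. awalk x w y}"
  have "?S \<noteq> {}"
  proof
    assume "?S = {}"
    then have "digraph_dist G x y = \<infinity>" unfolding digraph_dist_def by (simp add: Inf_enat_def)
    with le show False by simp
  qed
  then have "Inf ?S \<in> ?S" unfolding Inf_enat_def by (metis (mono_tags, lifting) LeastI ex_in_conv)
  with le show "\<exists>w. awalk x w y \<and> length w \<le> n"
    unfolding digraph_dist_def by auto
next
  assume "\<exists>w. awalk x w y \<and> length w \<le> n"
  then obtain w where w: "awalk x w y" "length w \<le> n" by blast
  then have "digraph_dist G x y \<le> enat (length w)"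
    unfolding digraph_dist_def by (intro INF_lower) simp
  with w show "digraph_dist G x y \<le> enat n" by (meson enat_ord_simps(1) order_trans)
qed

lemma awalk_arcs: "awalk x w y \<Longrightarrow> set w \<subseteq> parcs G"
  by (simp add: awalk_def)

lemma awalk_edge: "(x, y) \<in> parcs G \<Longrightarrow> awalk x [(x, y)] y"
  by (auto simp: awalk_def dest: wellformed')

lemma boundary_arc_chain: "awalk x w y \<Longrightarrow> RC_boundary (arc_chain w) = frag_of [y] - frag_of [x]"
proof (induction w arbitrary: x)
  case Nil
  then show ?case by (simp add: awalk_def)
next
  case (Cons e w)
  obtain a b where e: "e = (a, b)" by force
  with Cons.prems have "a = x" "awalk b w y" by (auto simp: awalk_Cons_iff)
  then show ?case using Cons.IH[of b] by (simp add: e RC_boundary_add)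
qed

lemma bigon_cycle:
  assumes "awalk x p y" "awalk x q y"
  shows "arc_chain p - arc_chain q \<in> edge_cycles (set p \<union> set q)"
proof -
  have "Poly_Mapping.keys (arc_chain p) \<subseteq> edge_tuples (set p \<union> set q)"
    "Poly_Mapping.keys (arc_chain q) \<subseteq> edge_tuples (set p \<union> set q)"
    using keys_arc_chain edge_tuples_mono by (meson order_trans sup_ge1 sup_ge2)+
  with assms show ?thesis
    by (simp add: edge_cycles_def RC_boundary_diff boundary_arc_chain keys_diff_subset)
qed

text \<open>
  A map from \<open>Gamma r\<close> to \<open>G\<close> is a pair of walks with common endpoints and \<open>r\<close> steps each, where
  a step may stay in place.
  The next two lemmas translate between such stuttering walks and arc walks of length at most \<open>r\<close>.
\<close>

lemma stuttering_walk_prefix: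
  assumes V: "h 0 \<in> pverts G"
    and h: "\<And>i. i < r \<Longrightarrow> (h i, h (Suc i)) \<in> parcs G \<or> h i = h (Suc i)"
  shows "i \<le> r \<Longrightarrow> \<exists>p. awalk (h 0) p (h i) \<and> length p \<le> i"
proof (induction i)
  case 0
  then show ?case using V by (auto simp: awalk_def)
next
  case (Suc i)
  then obtain p where p: "awalk (h 0) p (h i)" "length p \<le> i" by auto
  show ?case
  proof (cases "h i = h (Suc i)")
    case True
    with p show ?thesis by (metis le_SucI)
  next
    case False
    with h Suc.prems have "(h i, h (Suc i)) \<in> parcs G" by (meson Suc_le_eq)
    then have "awalk (h 0) (p @ [(h i, h (Suc i))]) (h (Suc i))"
      using p awalk_edge by (meson awalk_appendI)
    with p show ?thesis by (metis Suc_le_mono length_append_singleton)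
  qed
qed

lemma stuttering_walk_exists:
  assumes "awalk x p y" "length p \<le> r"
  shows "\<exists>h. h 0 = x \<and> h r = y \<and> (\<forall>i \<le> r. h i \<in> pverts G) \<and>
    (\<forall>i < r. (h i, h (Suc i)) \<in> parcs G \<or> h i = h (Suc i)) \<and>
    (\<forall>e \<in> set p. \<exists>i < r. e = (h i, h (Suc i)))"
  using assms
proof (induction p arbitrary: x r)
  case Nil
  then show ?case by (intro exI[of _ "\<lambda>_. x"]) (auto simp: awalk_def)
next
  case (Cons e p)
  obtain b r' where e: "e = (x, b)" "awalk b p y" and eG: "(x, b) \<in> parcs G" and r: "r = Suc r'" "length p \<le> r'"
    using Cons.prems by (cases e; cases r) (auto simp: awalk_Cons_iff)
  from Cons.IH[OF e(2) r(2)] obtain h where h: "h 0 = b" "h r' = y" "\<forall>i \<le> r'. h i \<in> pverts G"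
    "\<forall>i < r'. (h i, h (Suc i)) \<in> parcs G \<or> h i = h (Suc i)"
    "\<forall>e \<in> set p. \<exists>i < r'. e = (h i, h (Suc i))" by blast
  show ?case
  proof (intro exI[of _ "case_nat x h"] conjI allI impI ballI)
    show "case_nat x h i \<in> pverts G" if "i \<le> r" for i
      using that h eG r by (cases i) (auto dest: wellformed')
    show "(case_nat x h i, case_nat x h (Suc i)) \<in> parcs G \<or> case_nat x h i = case_nat x h (Suc i)"
      if "i < r" for i
      using that h eG r by (cases i) auto
    show "\<exists>i < r. e' = (case_nat x h i, case_nat x h (Suc i))" if "e' \<in> set (e # p)" for e'
    proof (cases "e' = e")
      case True
      then show ?thesis using r h e by (intro exI[of _ 0]) auto
    next
      case False
      with that h obtain i where "i < r'" "e' = (h i, h (Suc i))" by auto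
      then show ?thesis using r by (intro exI[of _ "Suc i"]) auto
    qed
  qed (use h r in auto)
qed

end

context pair_loopfree_digraph
begin

text \<open>
  The cone over the walk with apex its starting point \<open>x\<close>: the sum of the triples
  \<open>(x, a, b)\<close> over the arcs \<open>(a, b)\<close> of the walk. Each triple is at most as long as the
  initial segment of the walk that ends with its arc.
\<close>

lemma cone_chain:
  assumes "awalk x w y" "length w \<le> r"
  shows "\<exists>t. Poly_Mapping.keys t \<subseteq> short_triples r G \<and>
    RC_boundary t = arc_chain w - tuple_chain [x, y]"
  using assms
proof (induction w arbitrary: y rule: rev_induct)
  case Nil
  then show ?case by (intro exI[of _ 0]) (simp add: awalk_def tuple_chain_def)
next
  case (snoc e w)
  obtain a where e: "e = (a, y)" and w: "awalk x w a" and ay: "(a, y) \<in> parcs G"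
    using snoc.prems by (cases e) (auto simp: awalk_append_iff awalk_Cons_iff awalk_Nil_iff)
  have len: "Suc (length w) \<le> r" using snoc.prems by simp
  from snoc.IH[OF w] len obtain t where t: "Poly_Mapping.keys t \<subseteq> short_triples r G"
    "RC_boundary t = arc_chain w - tuple_chain [x, a]" by auto
  have "Poly_Mapping.keys (tuple_chain [x, a, y]) \<subseteq> short_triples r G"
  proof (cases "x = a")
    case False
    have "digraph_dist G x a \<le> enat (length w)" "digraph_dist G a y \<le> enat 1"
      using w awalk_edge[OF ay] unfolding digraph_dist_le_iff by auto
    then have "digraph_dist G x a + digraph_dist G a y \<le> enat (length w) + enat 1"
      by (rule add_mono)
    also have "\<dots> \<le> enat r" using len by simp
    finally have "[x, a, y] \<in> short_triples r G"
      using False ay w no_loops'[OF ay] by (auto simp: short_triples_def awalk_def dest: wellformed')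
    then show ?thesis using keys_tuple_chain by fastforce
  qed (simp add: tuple_chain_def)
  with t have "Poly_Mapping.keys (t + tuple_chain [x, a, y]) \<subseteq> short_triples r G"
    by (simp add: keys_add_subset)
  moreover have "RC_boundary (t + tuple_chain [x, a, y]) = arc_chain (w @ [e]) - tuple_chain [x, y]"
    using no_loops'[OF ay]
    by (simp add: RC_boundary_add RC_boundary_triple t e)
       (simp add: tuple_chain_def)
  ultimately show ?case by blast
qed

lemma bigon_in_short_boundaries:
  assumes "awalk x p y" "awalk x q y" "length p \<le> r" "length q \<le> r"
  shows "arc_chain p - arc_chain q \<in> short_boundaries r G"
proof -
  obtain s where s: "Poly_Mapping.keys s \<subseteq> short_triples r G"
    "RC_boundary s = arc_chain p - tuple_chain [x, y]" using cone_chain assms by blast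
  obtain t where t: "Poly_Mapping.keys t \<subseteq> short_triples r G"
    "RC_boundary t = arc_chain q - tuple_chain [x, y]" using cone_chain assms by blast
  have eq: "RC_boundary (s - t) = arc_chain p - arc_chain q"
    by (simp add: RC_boundary_diff s t)
  have "Poly_Mapping.keys (arc_chain p - arc_chain q) \<subseteq> edge_tuples (parcs G)"
    using keys_arc_chain[of p] keys_arc_chain[of q] awalk_arcs[OF assms(1)] awalk_arcs[OF assms(2)]
    by (meson edge_tuples_mono keys_diff_subset order_trans)
  with keys_diff_subset[OF s(1) t(1)] show ?thesis
    unfolding short_boundaries_def by (metis (mono_tags, lifting) eq image_eqI mem_Collect_eq)
qed

text \<open>
  Together with the previous lemma this says that the short boundaries are generated by the
  differences of walks of length at most \<open>r\<close> with common endpoints. Replacing every pair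
  \<open>(x, y)\<close> by a shortest walk fixes all edge chains and sends the boundary of a short triple
  \<open>(x, y, z)\<close> to such a difference: the walk through \<open>y\<close> against the shortest walk from \<open>x\<close>
  to \<open>z\<close>. A chain of short triples whose boundary consists of edges therefore has a boundary of
  the required form.
\<close>

lemma short_boundaries_least:
  assumes H: "chain_subgroup H"
    and bigon: "\<And>x y p q. awalk x p y \<Longrightarrow> awalk x q y \<Longrightarrow> length p \<le> r \<Longrightarrow> length q \<le> r \<Longrightarrow>
      arc_chain p - arc_chain q \<in> H"
  shows "short_boundaries r G \<subseteq> H"
proof
  \<comment> \<open>Minimality makes the chosen walk empty from a vertex to itself and a single arc along an edge.\<close>
  define P where "P x y = (SOME w. awalk x w y \<and> (\<forall>w'. awalk x w' y \<longrightarrow> length w \<le> length w'))" for x y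
  have P: "awalk x (P x y) y \<and> length (P x y) \<le> length w" if "awalk x w y" for x y w
  proof -
    have "\<exists>w. awalk x w y \<and> (\<forall>w'. awalk x w' y \<longrightarrow> length w \<le> length w')"
      using ex_has_least_nat[of "\<lambda>w. awalk x w y" w length] that by blast
    then have "awalk x (P x y) y \<and> (\<forall>w'. awalk x w' y \<longrightarrow> length (P x y) \<le> length w')"
      unfolding P_def by (rule someI_ex)
    with that show ?thesis by blast
  qed
  have P_refl: "P x x = []" if "x \<in> pverts G" for x
    using P[of x "[]" x] that by (simp add: awalk_Nil_iff)
  have P_edge: "P x y = [(x, y)]" if xy: "(x, y) \<in> parcs G" for x y
  proof -
    have "awalk x (P x y) y" "length (P x y) \<le> 1" using P[OF awalk_edge[OF xy]] by auto
    then show ?thesis using no_loops'[OF xy]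
      by (cases "P x y") (auto simp: awalk_Nil_iff awalk_Cons_iff)
  qed
  define \<phi> :: "('a list \<Rightarrow>\<^sub>0 int) \<Rightarrow> ('a list \<Rightarrow>\<^sub>0 int)"
    where "\<phi> = frag_extend (\<lambda>xs. arc_chain (P (hd xs) (last xs)))"
  have \<phi>_pair: "\<phi> (tuple_chain [x, y]) = arc_chain (P x y)" if "x \<in> pverts G" for x y
    using that P_refl by (auto simp: \<phi>_def tuple_chain_def)
  have \<phi>_edges: "\<phi> c = c" if "Poly_Mapping.keys c \<subseteq> edge_tuples (parcs G)" for c
    using that
    by (induction rule: frag_induction)
       (auto simp: \<phi>_def frag_extend_diff edge_tuples_def P_edge)
  have \<phi>_boundary: "\<phi> (RC_boundary t) \<in> H" if "Poly_Mapping.keys t \<subseteq> short_triples r G" for t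
    using that
  proof (induction rule: frag_induction)
    case zero
    show ?case using chain_subgroup_zero[OF H] by (simp add: \<phi>_def)
  next
    case (one xs)
    then obtain x y z where xs: "xs = [x, y, z]" and V: "x \<in> pverts G" "y \<in> pverts G" "z \<in> pverts G"
      and ne: "x \<noteq> y" "y \<noteq> z" and d: "digraph_dist G x y + digraph_dist G y z \<le> enat r"
      by (auto simp: short_triples_def)
    obtain k l where k: "digraph_dist G x y = enat k" and l: "digraph_dist G y z = enat l"
      and kl: "k + l \<le> r"
      using d by (cases "digraph_dist G x y"; cases "digraph_dist G y z") auto
    obtain u v where "awalk x u y" "length u \<le> k" "awalk y v z" "length v \<le> l"
      using digraph_dist_le_iff[of x y k] digraph_dist_le_iff[of y z l] k l by auto
    with P have p: "awalk x (P x y) y" "length (P x y) \<le> k" "awalk y (P y z) z" "length (P y z) \<le> l"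
      by (meson order_trans)+
    then have pp: "awalk x (P x y @ P y z) z" "length (P x y @ P y z) \<le> r"
      using kl awalk_appendI by auto
    then have "awalk x (P x z) z" "length (P x z) \<le> r" using P by (meson order_trans)+
    with pp have "arc_chain (P x y @ P y z) - arc_chain (P x z) \<in> H" using bigon by blast
    moreover have "frag_of xs = tuple_chain [x, y, z]" using ne by (simp add: xs tuple_chain_def)
    moreover have "\<phi> (RC_boundary (tuple_chain [x, y, z]))
        = arc_chain (P x y @ P y z) - arc_chain (P x z)"
      using V \<phi>_pair[of x y] \<phi>_pair[of y z] \<phi>_pair[of x z]
      by (simp add: RC_boundary_triple) (simp add: \<phi>_def frag_extend_add frag_extend_diff)
    ultimately show ?case by simp
  next
    case (diff a b)
    then show ?case
      using chain_subgroup_diff[OF H] unfolding \<phi>_def boundary_frag_extend_diff by blast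
  qed
  fix c assume "c \<in> short_boundaries r G"
  then obtain t where "c = RC_boundary t" "Poly_Mapping.keys t \<subseteq> short_triples r G"
    "Poly_Mapping.keys c \<subseteq> edge_tuples (parcs G)" by (auto simp: short_boundaries_def)
  then show "c \<in> H" using \<phi>_edges[of c] \<phi>_boundary[of t] by simp
qed

section \<open>Cycles on degenerate \<open>\<Gamma>\<^sub>r\<close>'s\<close>

text \<open>
  Fix for every vertex \<open>v\<close> a walk \<open>T v\<close> of length at most \<open>r\<close> from \<open>x\<close>. For an edge \<open>(a, b)\<close> of
  \<open>E\<close> the closed chain formed by \<open>T a\<close>, the edge and the reverse of \<open>T b\<close> is a sum of two differences
  of short walks, obtained by inserting a walk to \<open>a\<close> that is short enough to be continued along the
  edge. In a cycle on \<open>E\<close> the contributions of \<open>T\<close> cancel.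
\<close>

lemma out_ball_cycles:
  assumes E: "\<And>a b. (a, b) \<in> E \<Longrightarrow> (a, b) \<in> parcs G \<and> (\<exists>p. awalk x p a \<and> length p < r)"
  shows "edge_cycles E \<subseteq> short_boundaries r G"
proof
  note sub = chain_subgroup_short_boundaries[of r G]
  define T where "T v = (SOME p. awalk x p v \<and> length p \<le> r)" for v
  have T: "awalk x (T v) v \<and> length (T v) \<le> r" if "awalk x p v" "length p \<le> r" for p v
    unfolding T_def using that someI[of "\<lambda>p. awalk x p v \<and> length p \<le> r" p] by blast
  have rel: "c - frag_extend (\<lambda>xs. arc_chain (T (hd xs))) (RC_boundary c) \<in> short_boundaries r G"
    if "Poly_Mapping.keys c \<subseteq> edge_tuples E" for c
    using that
  proof (induction rule: frag_induction)
    case zero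
    show ?case using chain_subgroup_zero[OF sub] by simp
  next
    case (one xs)
    then obtain a b where xs: "xs = [a, b]" and ab: "(a, b) \<in> E" by (auto simp: edge_tuples_def)
    from E[OF ab] obtain p where p: "awalk x p a" "length p < r" and abG: "(a, b) \<in> parcs G" by blast
    have q: "awalk x (p @ [(a, b)]) b" "length (p @ [(a, b)]) \<le> r"
      using awalk_appendI[OF p(1) awalk_edge[OF abG]] p(2) by auto
    have "arc_chain (T a) - arc_chain p \<in> short_boundaries r G"
      using T[OF p(1)] p by (intro bigon_in_short_boundaries[of x _ a]) auto
    moreover have "arc_chain (p @ [(a, b)]) - arc_chain (T b) \<in> short_boundaries r G"
      using T[OF q] q by (intro bigon_in_short_boundaries[of x _ b]) auto
    ultimately have "arc_chain (T a) - arc_chain p + (arc_chain (p @ [(a, b)]) - arc_chain (T b))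
        \<in> short_boundaries r G" by (rule chain_subgroup_add[OF sub])
    then show ?case by (simp add: xs frag_extend_diff algebra_simps)
  next
    case (diff c d)
    have "c - d - frag_extend (\<lambda>xs. arc_chain (T (hd xs))) (RC_boundary (c - d))
      = (c - frag_extend (\<lambda>xs. arc_chain (T (hd xs))) (RC_boundary c))
        - (d - frag_extend (\<lambda>xs. arc_chain (T (hd xs))) (RC_boundary d))"
      unfolding boundary_frag_extend_diff by simp
    then show ?case using chain_subgroup_diff[OF sub diff] by (simp only:)
  qed
  then show "c \<in> short_boundaries r G" if "c \<in> edge_cycles E" for c
    using that rel[of c] by (simp add: edge_cycles_def)
qed

text \<open>
  Both sides of \<open>Gamma r\<close> reach each of their edges from \<open>u\<^sub>0\<close> in fewer than \<open>r\<close> steps. Hence not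
  only the image of the defining loop but every cycle on a degenerate \<open>\<Gamma>\<^sub>r\<close> is a short boundary,
  also when the images of the two sides cross in different orders.
\<close>

lemma degenerate_Gamma_cycles:
  assumes "degenerate_Gamma r G L"
  shows "edge_cycles (parcs L) \<subseteq> short_boundaries r G"
proof -
  obtain g where g: "digraph_map (Gamma r) G g" and L: "L = digraph_image (Gamma r) g"
    using assms by (auto simp: degenerate_Gamma_def)
  let ?u = "\<lambda>i. g (Gamma_u i)" and ?v = "\<lambda>i. g (Gamma_v r i)"
  have same: "?v 0 = ?u 0" by (simp add: Gamma_u_def Gamma_v_def)
  have V: "?u 0 \<in> pverts G"
    using g by (auto simp: digraph_map_def Gamma_def)
  have u: "(?u i, ?u (Suc i)) \<in> parcs G \<or> ?u i = ?u (Suc i)"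
    and v: "(?v i, ?v (Suc i)) \<in> parcs G \<or> ?v i = ?v (Suc i)" if "i < r" for i
    using g that by (fastforce simp: digraph_map_def Gamma_def)+
  show ?thesis
  proof (rule out_ball_cycles)
    fix a b assume "(a, b) \<in> parcs L"
    then obtain i where i: "i < r" and ab: "a \<noteq> b"
      "(a, b) = (?u i, ?u (Suc i)) \<or> (a, b) = (?v i, ?v (Suc i))"
      by (auto simp: L digraph_image_def Gamma_def)
    have "\<exists>p. awalk (?u 0) p (?u i) \<and> length p \<le> i" "\<exists>p. awalk (?u 0) p (?v i) \<and> length p \<le> i"
      using stuttering_walk_prefix[of ?u r i] stuttering_walk_prefix[of ?v r i] u v V i same by auto
    with i ab u[OF i] v[OF i]
    show "(a, b) \<in> parcs G \<and> (\<exists>p. awalk (?u 0) p a \<and> length p < r)"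
      by (metis le_less_trans prod.inject)
  qed
qed

lemma bigon_in_degenerate_Gamma:
  assumes "awalk x p y" "awalk x q y" "length p \<le> r" "length q \<le> r"
  obtains L where "degenerate_Gamma r G L" "set p \<union> set q \<subseteq> parcs L"
proof -
  obtain h where h: "h 0 = x" "h r = y" "\<forall>i \<le> r. h i \<in> pverts G"
    "\<forall>i < r. (h i, h (Suc i)) \<in> parcs G \<or> h i = h (Suc i)"
    "\<forall>e \<in> set p. \<exists>i < r. e = (h i, h (Suc i))"
    using stuttering_walk_exists[OF assms(1,3)] by blast
  obtain k where k: "k 0 = x" "k r = y" "\<forall>i \<le> r. k i \<in> pverts G"
    "\<forall>i < r. (k i, k (Suc i)) \<in> parcs G \<or> k i = k (Suc i)"
    "\<forall>e \<in> set q. \<exists>i < r. e = (k i, k (Suc i))"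
    using stuttering_walk_exists[OF assms(2,4)] by blast
  \<comment> \<open>At \<open>v\<^sub>0\<close> and \<open>v\<^sub>r\<close>, which carry the label \<open>False\<close>, the walks \<open>h\<close> and \<open>k\<close> agree.\<close>
  define g where "g = (\<lambda>(i, b). if b then k i else h i)"
  have u: "g (Gamma_u i) = h i" for i by (simp add: g_def Gamma_u_def)
  have v: "g (Gamma_v r i) = k i" if "i \<le> r" for i
    using that h k by (cases "i = 0 \<or> i = r") (auto simp: g_def Gamma_v_def)
  show ?thesis
  proof
    have "digraph_map (Gamma r) G g"
      using h k by (auto simp: digraph_map_def Gamma_def u v)
    then show "degenerate_Gamma r G (digraph_image (Gamma r) g)"
      by (auto simp: degenerate_Gamma_def)
    have "e \<in> parcs (digraph_image (Gamma r) g)" if e: "e \<in> set p \<union> set q" for e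
    proof -
      have "e \<in> parcs G" using e awalk_arcs assms by blast
      then have ne: "fst e \<noteq> snd e" by (rule pair_no_loops)
      from e obtain i where i: "i < r" "e = (h i, h (Suc i)) \<or> e = (k i, k (Suc i))"
        using h k by blast
      then have "e = (g (Gamma_u i), g (Gamma_u (Suc i))) \<or> e = (g (Gamma_v r i), g (Gamma_v r (Suc i)))"
        by (simp add: u v)
      moreover have "(Gamma_u i, Gamma_u (Suc i)) \<in> parcs (Gamma r)"
        "(Gamma_v r i, Gamma_v r (Suc i)) \<in> parcs (Gamma r)"
        using i by (auto simp: Gamma_def)
      ultimately show ?thesis using ne digraph_image_arc by (metis fst_conv snd_conv)
    qed
    then show "set p \<union> set q \<subseteq> parcs (digraph_image (Gamma r) g)" by blast
  qed
qed

end

section \<open>The page in bidegree (1, 0)\<close>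

context pair_loopfree_digraph
begin

lemma RC_gens_length_le_1:
  "{xs \<in> RC_gens G 1. \<exists>l. tuple_length G xs = enat l \<and> int l \<le> 1} = edge_tuples (parcs G)"
proof -
  have gen_imp: "xs \<in> edge_tuples (parcs G)"
    if xs: "xs \<in> RC_gens G 1" "tuple_length G xs = enat l" "int l \<le> 1" for xs l
  proof -
    have "length xs = 2" using xs by (simp add: RC_gens_def)
    then obtain x y where xy: "xs = [x, y]" by (auto simp: length_Suc_conv eval_nat_numeral)
    have "x \<noteq> y" using xs by (simp add: xy RC_gens_def)
    have "digraph_dist G x y \<le> enat 1" using xs by (simp add: xy tuple_length_def)
    then obtain w where "awalk x w y" "length w \<le> 1" unfolding digraph_dist_le_iff by blast
    with \<open>x \<noteq> y\<close> have "(x, y) \<in> parcs G"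
      by (cases w) (auto simp: awalk_Nil_iff awalk_Cons_iff)
    then show ?thesis by (auto simp: xy edge_tuples_def)
  qed
  have imp_gen: "xs \<in> RC_gens G 1 \<and> (\<exists>l. tuple_length G xs = enat l \<and> int l \<le> 1)"
    if xs: "xs \<in> edge_tuples (parcs G)" for xs
  proof -
    obtain x y where xs: "xs = [x, y]" and xy: "(x, y) \<in> parcs G"
      using xs by (auto simp: edge_tuples_def)
    have "digraph_dist G x y \<le> enat 1" unfolding digraph_dist_le_iff using awalk_edge[OF xy] by force
    then obtain l where "digraph_dist G x y = enat l" "l \<le> 1" by (cases "digraph_dist G x y") auto
    with wellformed'[OF xy] no_loops'[OF xy] show ?thesis
      by (auto simp: xs RC_gens_def tuple_length_def)
  qed
  show ?thesis
  proof (intro equalityI subsetI)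
    fix xs assume "xs \<in> {xs \<in> RC_gens G 1. \<exists>l. tuple_length G xs = enat l \<and> int l \<le> 1}"
    then show "xs \<in> edge_tuples (parcs G)" by (elim CollectE conjE exE) (rule gen_imp)
  next
    fix xs assume "xs \<in> edge_tuples (parcs G)"
    then show "xs \<in> {xs \<in> RC_gens G 1. \<exists>l. tuple_length G xs = enat l \<and> int l \<le> 1}" by (intro CollectI imp_gen)
  qed
qed

lemma F_RC_edges: "carrier (F_RC G 1 1) = {c. Poly_Mapping.keys c \<subseteq> edge_tuples (parcs G)}"
  unfolding F_RC_def RC_gens_length_le_1 by (simp add: free_Abelian_group_def)

lemma F_RC_triples: "carrier (F_RC G (int r) 2) = {c. Poly_Mapping.keys c \<subseteq> short_triples r G}"
proof -
  have gen_imp: "xs \<in> short_triples r G"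
    if xs: "xs \<in> RC_gens G 2" "tuple_length G xs = enat l" "int l \<le> int r" for xs l
  proof -
    have "length xs = 3" using xs by (simp add: RC_gens_def)
    then obtain x y z where "xs = [x, y, z]" by (auto simp: length_Suc_conv eval_nat_numeral)
    with xs show ?thesis by (auto simp: RC_gens_def short_triples_def tuple_length_def lessThan_Suc add.commute)
  qed
  have imp_gen: "xs \<in> RC_gens G 2 \<and> (\<exists>l. tuple_length G xs = enat l \<and> int l \<le> int r)"
    if xs: "xs \<in> short_triples r G" for xs
  proof -
    obtain x y z where xyz: "xs = [x, y, z]" "{x, y, z} \<subseteq> pverts G" "x \<noteq> y" "y \<noteq> z"
      and d: "digraph_dist G x y + digraph_dist G y z \<le> enat r"
      using xs by (auto simp: short_triples_def)
    have "tuple_length G xs = digraph_dist G x y + digraph_dist G y z"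
      by (simp add: xyz tuple_length_def lessThan_Suc add.commute)
    with d have "tuple_length G xs \<le> enat r" by simp
    then obtain l where "tuple_length G xs = enat l" "l \<le> r" by (cases "tuple_length G xs") auto
    with xyz show ?thesis by (auto simp: RC_gens_def)
  qed
  have "{xs \<in> RC_gens G 2. \<exists>l. tuple_length G xs = enat l \<and> int l \<le> int r} = short_triples r G"
  proof (intro equalityI subsetI)
    fix xs assume "xs \<in> {xs \<in> RC_gens G 2. \<exists>l. tuple_length G xs = enat l \<and> int l \<le> int r}"
    then show "xs \<in> short_triples r G" by (elim CollectE conjE exE) (rule gen_imp)
  next
    fix xs assume "xs \<in> short_triples r G"
    then show "xs \<in> {xs \<in> RC_gens G 2. \<exists>l. tuple_length G xs = enat l \<and> int l \<le> int r}" by (intro CollectI imp_gen)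
  qed
  then show ?thesis by (simp add: F_RC_def free_Abelian_group_def)
qed

lemma F_RC_negative: "p < 0 \<Longrightarrow> carrier (F_RC G p n) = {0}"
  by (auto simp: F_RC_def)

lemma F_RC_0_1: "carrier (F_RC G 0 1) = {0}"
proof -
  have False if "xs \<in> RC_gens G 1" "tuple_length G xs = enat 0" for xs
  proof -
    have "length xs = 2" using that by (simp add: RC_gens_def)
    then obtain x y where xy: "xs = [x, y]" by (auto simp: length_Suc_conv eval_nat_numeral)
    have "digraph_dist G x y \<le> enat 0" using that by (simp add: xy tuple_length_def)
    then have "x = y" unfolding digraph_dist_le_iff by (auto simp: awalk_Nil_iff)
    with that show False by (simp add: xy RC_gens_def)
  qed
  then have empty: "{xs \<in> RC_gens G 1. \<exists>l. tuple_length G xs = enat l \<and> int l \<le> 0} = {}" by auto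
  show ?thesis unfolding F_RC_def empty by auto
qed

text \<open>
  The boundary of a cycle of page \<open>r\<close> in filtration degree 1 lies in filtration degree
  \<open>1 - r < 0\<close>, hence vanishes.
\<close>

lemma MPSS_Z_eq_edge_cycles:
  assumes "2 \<le> r"
  shows "MPSS_Z G (int r) 1 0 = edge_cycles (parcs G)"
  using assms by (auto simp: MPSS_Z_def F_RC_edges F_RC_negative edge_cycles_def)

lemma MPSS_B_eq_short_boundaries:
  assumes "2 \<le> r"
  shows "MPSS_B G (int r) 1 0 = short_boundaries r G"
proof -
  have "MPSS_Z G (int r - 1) 0 1 = {0}"
    using assms by (auto simp: MPSS_Z_def F_RC_0_1 F_RC_negative)
  moreover have "RC_boundary ` MPSS_Z G (int r - 1) (int r) (2 - int r) = short_boundaries r G"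
    by (simp add: MPSS_Z_def F_RC_triples F_RC_edges short_boundaries_def)
  ultimately show ?thesis
    by (simp add: MPSS_B_def set_mult_def RC_def)
qed

lemma short_boundaries_subset_edge_cycles: "short_boundaries r G \<subseteq> edge_cycles (parcs G)"
proof (rule short_boundaries_least[OF chain_subgroup_edge_cycles])
  fix x y p q assume "awalk x p y" "awalk x q y"
  then show "arc_chain p - arc_chain q \<in> edge_cycles (parcs G)"
    using bigon_cycle edge_cycles_mono awalk_arcs by (meson Un_least subsetD)
qed

lemma edge_cycle_in_RC: "c \<in> edge_cycles (parcs G) \<Longrightarrow> Poly_Mapping.keys c \<subseteq> RC_gens G 1"
  unfolding edge_cycles_def RC_gens_length_le_1[symmetric] by blast

lemma RC_map_id: "c \<in> edge_cycles (parcs G) \<Longrightarrow> RC_map id c = c"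
proof -
  assume "c \<in> edge_cycles (parcs G)"
  then have "Poly_Mapping.keys c \<subseteq> edge_tuples (parcs G)" by (simp add: edge_cycles_def)
  then show ?thesis
    by (induction rule: frag_induction)
       (auto simp: RC_map_def frag_extend_diff edge_tuples_def tuple_chain_def dest: no_loops')
qed

end

text \<open>
  Distances can be smaller in the larger graph. The description by walks, which inclusions
  preserve, avoids comparing them.
\<close>

lemma short_boundaries_mono:
  assumes "pair_loopfree_digraph G" "pair_loopfree_digraph G'"
    and "pverts G \<subseteq> pverts G'" "parcs G \<subseteq> parcs G'"
  shows "short_boundaries r G \<subseteq> short_boundaries r G'"
proof (rule pair_loopfree_digraph.short_boundaries_least[OF assms(1) chain_subgroup_short_boundaries])
  interpret G: pair_loopfree_digraph G by fact
  interpret G': pair_loopfree_digraph G' by fact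
  fix x y p q assume "G.awalk x p y" "G.awalk x q y" "length p \<le> r" "length q \<le> r"
  moreover from this have "G'.awalk x p y" "G'.awalk x q y"
    using assms(3,4) by (auto simp: G.awalk_def G'.awalk_def)
  ultimately show "arc_chain p - arc_chain q \<in> short_boundaries r G'"
    by (intro G'.bigon_in_short_boundaries)
qed

text \<open>
  This is where separability enters: a difference of two short walks is a cycle on a degenerate
  \<open>\<Gamma>\<^sub>r\<close>, hence a sum of cycles on the pieces of a subdivision, and on each piece every cycle is a
  short boundary in \<open>X\<close> or in \<open>Y\<close>.
\<close>

lemma short_boundaries_union:
  assumes X: "pair_loopfree_digraph X" and Y: "pair_loopfree_digraph Y"
    and U: "pair_loopfree_digraph (X \<union>\<^sub>G Y)" and sep: "separable r X Y"
    and c: "c \<in> short_boundaries r (X \<union>\<^sub>G Y)"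
  obtains a b where "a \<in> short_boundaries r X" "b \<in> short_boundaries r Y" "c = a + b"
proof -
  interpret U: pair_loopfree_digraph "X \<union>\<^sub>G Y" by fact
  let ?H = "{a + b |a b. a \<in> short_boundaries r X \<and> b \<in> short_boundaries r Y}"
  note sX = chain_subgroup_short_boundaries[of r X] and sY = chain_subgroup_short_boundaries[of r Y]
  have H: "chain_subgroup ?H"
  proof (rule chain_subgroupI)
    show "0 \<in> ?H" using chain_subgroup_zero[OF sX] chain_subgroup_zero[OF sY] by force
    fix c d assume "c \<in> ?H" "d \<in> ?H"
    then obtain a b a' b' where "a \<in> short_boundaries r X" "b \<in> short_boundaries r Y" "c = a + b"
      "a' \<in> short_boundaries r X" "b' \<in> short_boundaries r Y" "d = a' + b'" by blast
    moreover from this have "c - d = (a - a') + (b - b')" by simp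
    ultimately show "c - d \<in> ?H"
      using chain_subgroup_diff[OF sX] chain_subgroup_diff[OF sY] by blast
  qed
  have "short_boundaries r X \<subseteq> ?H" "short_boundaries r Y \<subseteq> ?H"
    using chain_subgroup_zero[OF sX] chain_subgroup_zero[OF sY] by force+
  then have piece: "edge_cycles (parcs M) \<subseteq> ?H" if "degenerate_Gamma r X M \<or> degenerate_Gamma r Y M" for M
    using that pair_loopfree_digraph.degenerate_Gamma_cycles[OF X]
      pair_loopfree_digraph.degenerate_Gamma_cycles[OF Y] by (meson order_trans)
  have "short_boundaries r (X \<union>\<^sub>G Y) \<subseteq> ?H"
  proof (rule U.short_boundaries_least[OF H])
    fix x y p q assume pq: "U.awalk x p y" "U.awalk x q y" "length p \<le> r" "length q \<le> r"
    obtain L where L: "degenerate_Gamma r (X \<union>\<^sub>G Y) L" "set p \<union> set q \<subseteq> parcs L"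
      by (rule U.bigon_in_degenerate_Gamma[OF pq])
    obtain Ls where "subdivision (X \<union>\<^sub>G Y) L Ls"
      "\<forall>M \<in> set Ls. degenerate_Gamma r X M \<or> degenerate_Gamma r Y M"
      using sep L(1) by (auto simp: separable_def)
    then have "edge_cycles (parcs L) \<subseteq> ?H" using subdivision_cycles[OF _ H] piece by blast
    moreover have "arc_chain p - arc_chain q \<in> edge_cycles (parcs L)"
      using U.bigon_cycle[OF pq(1,2)] edge_cycles_mono[OF L(2)] by blast
    ultimately show "arc_chain p - arc_chain q \<in> ?H" by blast
  qed
  with c that show ?thesis by blast
qed

section \<open>Exact sequences of quotients\<close>

text \<open>
  The cosets of a subgroup of a free abelian group depend on neither the set of generators nor the
  carrier; a constant without these parameters lets cosets in different graphs be compared directly.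
\<close>

definition coset :: "('b \<Rightarrow>\<^sub>0 int) set \<Rightarrow> ('b \<Rightarrow>\<^sub>0 int) \<Rightarrow> ('b \<Rightarrow>\<^sub>0 int) set" where
  "coset B c = (\<lambda>b. b + c) ` B"

lemma r_coset_eq_coset: "B #>\<^bsub>free_Abelian_group S\<^esub> c = coset B c"
  by (auto simp: r_coset_def coset_def)

lemma coset_eq_iff:
  assumes B: "chain_subgroup B"
  shows "coset B a = coset B b \<longleftrightarrow> a - b \<in> B"
proof
  assume "coset B a = coset B b"
  moreover have "a \<in> coset B a" using chain_subgroup_zero[OF B] by (force simp: coset_def)
  ultimately show "a - b \<in> B" by (auto simp: coset_def)
next
  assume ab: "a - b \<in> B"
  have *: "coset B c \<subseteq> coset B d" if "c - d \<in> B" for c d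
  proof
    fix x assume "x \<in> coset B c"
    then obtain e where "e \<in> B" "x = e + c" by (auto simp: coset_def)
    then have "x = (e + (c - d)) + d" "e + (c - d) \<in> B" using chain_subgroup_add[OF B _ that] by auto
    then show "x \<in> coset B d" unfolding coset_def by blast
  qed
  have "b - a \<in> B" using chain_subgroup_minus[OF B ab] by simp
  with * ab show "coset B a = coset B b" by blast
qed

locale chain_quotient =
  fixes S :: "'b set" and Z B :: "('b \<Rightarrow>\<^sub>0 int) set"
  assumes Z: "chain_subgroup Z" and B: "chain_subgroup B" and BZ: "B \<subseteq> Z"
    and ZS: "\<And>c. c \<in> Z \<Longrightarrow> Poly_Mapping.keys c \<subseteq> S"
begin

abbreviation "A \<equiv> free_Abelian_group S\<lparr>carrier := Z\<rparr>"
abbreviation "Q \<equiv> A Mod B"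

lemma sub: "subgroup Z (free_Abelian_group S)"
  by (rule group.subgroupI)
     (use ZS chain_subgroup_zero[OF Z] chain_subgroup_add[OF Z] chain_subgroup_minus[OF Z] in auto)

lemma group_A: "group A"
  by (rule subgroup.subgroup_is_group[OF sub]) simp

lemma comm_group_A: "comm_group A"
  by (rule group.group_comm_groupI[OF group_A]) (simp add: add.commute)

lemma inv_A: "a \<in> Z \<Longrightarrow> inv\<^bsub>A\<^esub> a = - a"
  by (rule group.inv_equality[OF group_A]) (simp_all add: chain_subgroup_minus[OF Z])

lemma subgroup_B: "subgroup B A"
proof (rule group.subgroupI[OF group_A])
  show "inv\<^bsub>A\<^esub> a \<in> B" if "a \<in> B" for a
    using that BZ inv_A chain_subgroup_minus[OF B] by (simp add: subset_iff)
qed (use BZ chain_subgroup_zero[OF B] chain_subgroup_add[OF B] in auto)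

lemma normal_B: "normal B A"
  using comm_group.subgroup_imp_normal[OF comm_group_A subgroup_B] .

lemma group_Q: "group Q"
  using normal.factorgroup_is_group[OF normal_B] .

lemma carrier_Q: "carrier Q = coset B ` Z"
  by (simp add: carrier_FactGroup r_coset_eq_coset)

lemma coset_in_Q: "c \<in> Z \<Longrightarrow> coset B c \<in> carrier Q"
  by (simp add: carrier_Q)

lemma mult_Q: "a \<in> Z \<Longrightarrow> b \<in> Z \<Longrightarrow> coset B a \<otimes>\<^bsub>Q\<^esub> coset B b = coset B (a + b)"
  using normal.rcos_sum[OF normal_B, of a b] by (simp add: r_coset_eq_coset)

lemma one_Q: "\<one>\<^bsub>Q\<^esub> = coset B 0"
  by (simp add: coset_def)

lemma inv_Q: "a \<in> Z \<Longrightarrow> inv\<^bsub>Q\<^esub> coset B a = coset B (- a)"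
  by (rule group.inv_equality[OF group_Q])
     (simp_all add: mult_Q one_Q coset_in_Q chain_subgroup_minus[OF Z] del: one_FactGroup mult_FactGroup)

end

text \<open>
  If the class of \<open>(a, b)\<close> is in the kernel, then \<open>a - b = m + n\<close> with \<open>m\<close> in \<open>B1\<close> and \<open>n\<close> in \<open>B2\<close>, so
  \<open>a - m = b + n\<close> is an element of \<open>Z1 \<inter> Z2 = Z0\<close> representing both classes.
\<close>

lemma right_exact_quotients:
  fixes S0 S1 S2 S3 :: "'b set" and Z0 Z1 Z2 Z3 B0 B1 B2 B3 :: "('b \<Rightarrow>\<^sub>0 int) set"
  defines "Q0 \<equiv> free_Abelian_group S0\<lparr>carrier := Z0\<rparr> Mod B0"
    and "Q1 \<equiv> free_Abelian_group S1\<lparr>carrier := Z1\<rparr> Mod B1"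
    and "Q2 \<equiv> free_Abelian_group S2\<lparr>carrier := Z2\<rparr> Mod B2"
    and "Q3 \<equiv> free_Abelian_group S3\<lparr>carrier := Z3\<rparr> Mod B3"
  assumes q0: "chain_quotient S0 Z0 B0" and q1: "chain_quotient S1 Z1 B1"
    and q2: "chain_quotient S2 Z2 B2" and q3: "chain_quotient S3 Z3 B3"
    and Z0: "Z0 = Z1 \<inter> Z2" and Z3: "Z3 = {a + b |a b. a \<in> Z1 \<and> b \<in> Z2}"
    and B01: "B0 \<subseteq> B1" and B02: "B0 \<subseteq> B2" and B3: "B3 = {a + b |a b. a \<in> B1 \<and> b \<in> B2}"
    and f1: "\<And>c. c \<in> Z0 \<Longrightarrow> f1 (coset B0 c) = coset B1 c"
    and f2: "\<And>c. c \<in> Z0 \<Longrightarrow> f2 (coset B0 c) = coset B2 c"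
    and g1: "\<And>c. c \<in> Z1 \<Longrightarrow> g1 (coset B1 c) = coset B3 c"
    and g2: "\<And>c. c \<in> Z2 \<Longrightarrow> g2 (coset B2 c) = coset B3 c"
  shows "right_exact Q0 (Q1 \<times>\<times> Q2) Q3 (\<lambda>c. (f1 c, f2 c)) (\<lambda>(a, b). g1 a \<otimes>\<^bsub>Q3\<^esub> inv\<^bsub>Q3\<^esub> g2 b)"
proof -
  interpret q0: chain_quotient S0 Z0 B0 by fact
  interpret q1: chain_quotient S1 Z1 B1 by fact
  interpret q2: chain_quotient S2 Z2 B2 by fact
  interpret q3: chain_quotient S3 Z3 B3 by fact
  note Q_simps = q0.mult_Q[folded Q0_def] q1.mult_Q[folded Q1_def] q2.mult_Q[folded Q2_def]
    q3.mult_Q[folded Q3_def] q3.inv_Q[folded Q3_def]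
  note carriers = q0.carrier_Q[folded Q0_def] q1.carrier_Q[folded Q1_def]
    q2.carrier_Q[folded Q2_def] q3.carrier_Q[folded Q3_def]
  note groups = q0.group_Q[folded Q0_def] q1.group_Q[folded Q1_def]
    q2.group_Q[folded Q2_def] q3.group_Q[folded Q3_def]
  have Z13: "Z1 \<subseteq> Z3" and Z23: "Z2 \<subseteq> Z3"
    using chain_subgroup_zero[OF q1.Z] chain_subgroup_zero[OF q2.Z] unfolding Z3 by force+
  let ?\<phi> = "\<lambda>c. (f1 c, f2 c)" and ?\<psi> = "\<lambda>(a, b). g1 a \<otimes>\<^bsub>Q3\<^esub> inv\<^bsub>Q3\<^esub> g2 b"
  have \<phi>: "?\<phi> (coset B0 c) = (coset B1 c, coset B2 c)" if "c \<in> Z0" for c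
    using that by (simp add: f1 f2)
  have \<psi>: "?\<psi> (coset B1 a, coset B2 b) = coset B3 (a - b)" if "a \<in> Z1" "b \<in> Z2" for a b
  proof -
    have "a \<in> Z3" "b \<in> Z3" "- b \<in> Z3" using that Z13 Z23 chain_subgroup_minus[OF q3.Z] by auto
    with that show ?thesis by (simp add: g1 g2 Q_simps)
  qed
  have hom\<phi>: "?\<phi> \<in> hom Q0 (Q1 \<times>\<times> Q2)"
  proof (rule homI)
    fix u assume "u \<in> carrier Q0"
    then show "?\<phi> u \<in> carrier (Q1 \<times>\<times> Q2)" using \<phi> Z0 by (auto simp: carriers)
  next
    fix u v assume "u \<in> carrier Q0" "v \<in> carrier Q0"
    then obtain c d where "c \<in> Z0" "d \<in> Z0" "u = coset B0 c" "v = coset B0 d" by (auto simp: carriers)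
    then show "?\<phi> (u \<otimes>\<^bsub>Q0\<^esub> v) = ?\<phi> u \<otimes>\<^bsub>Q1 \<times>\<times> Q2\<^esub> ?\<phi> v"
      using chain_subgroup_add[OF q0.Z] Z0 by (simp add: Q_simps f1 f2)
  qed
  have hom\<psi>: "?\<psi> \<in> hom (Q1 \<times>\<times> Q2) Q3"
  proof (rule homI)
    fix u assume "u \<in> carrier (Q1 \<times>\<times> Q2)"
    then obtain a b where ab: "a \<in> Z1" "b \<in> Z2" "u = (coset B1 a, coset B2 b)" by (auto simp: carriers)
    then have "a - b \<in> Z3" using Z13 Z23 chain_subgroup_diff[OF q3.Z] by blast
    then show "?\<psi> u \<in> carrier Q3" unfolding ab(3) \<psi>[OF ab(1,2)] by (simp add: carriers)
  next
    fix u v assume "u \<in> carrier (Q1 \<times>\<times> Q2)" "v \<in> carrier (Q1 \<times>\<times> Q2)"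
    then obtain a b c d where ab: "a \<in> Z1" "b \<in> Z2" "u = (coset B1 a, coset B2 b)"
      and cd: "c \<in> Z1" "d \<in> Z2" "v = (coset B1 c, coset B2 d)" by (auto simp: carriers)
    have "u \<otimes>\<^bsub>Q1 \<times>\<times> Q2\<^esub> v = (coset B1 (a + c), coset B2 (b + d))"
      using ab cd by (simp add: Q_simps)
    moreover have "?\<psi> (coset B1 (a + c), coset B2 (b + d)) = coset B3 ((a + c) - (b + d))"
      using ab cd chain_subgroup_add[OF q1.Z] chain_subgroup_add[OF q2.Z] by (intro \<psi>)
    moreover have "?\<psi> u \<otimes>\<^bsub>Q3\<^esub> ?\<psi> v = coset B3 ((a - b) + (c - d))"
      unfolding ab(3) cd(3) \<psi>[OF ab(1,2)] \<psi>[OF cd(1,2)]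
      using ab cd Z13 Z23 chain_subgroup_diff[OF q3.Z] by (intro Q_simps) blast+
    moreover have "(a + c) - (b + d) = (a - b) + (c - d)" by simp
    ultimately show "?\<psi> (u \<otimes>\<^bsub>Q1 \<times>\<times> Q2\<^esub> v) = ?\<psi> u \<otimes>\<^bsub>Q3\<^esub> ?\<psi> v" by metis
  qed
  have one: "\<one>\<^bsub>Q3\<^esub> = coset B3 0" using q3.one_Q by (simp add: Q3_def)
  have kernel: "kernel (Q1 \<times>\<times> Q2) Q3 ?\<psi> = ?\<phi> ` carrier Q0"
  proof (rule equalityI; rule subsetI)
    fix u assume u: "u \<in> kernel (Q1 \<times>\<times> Q2) Q3 ?\<psi>"
    then obtain a b where ab: "a \<in> Z1" "b \<in> Z2" "u = (coset B1 a, coset B2 b)"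
      by (auto simp: kernel_def carriers)
    have "?\<psi> u = coset B3 0" using u one by (simp add: kernel_def)
    then have "a - b \<in> B3" unfolding ab(3) \<psi>[OF ab(1,2)] coset_eq_iff[OF q3.B] by simp
    then obtain m n where mn: "m \<in> B1" "n \<in> B2" "a - b = m + n" unfolding B3 by blast
    then have eq: "a - m = b + n" by (metis add.commute diff_add_cancel add_diff_cancel_left' diff_diff_eq2 diff_eq_eq)
    have "a - m \<in> Z1" using ab mn q1.BZ chain_subgroup_diff[OF q1.Z] by blast
    moreover have "b + n \<in> Z2" using ab mn q2.BZ chain_subgroup_add[OF q2.Z] by blast
    ultimately have c: "a - m \<in> Z0" by (simp add: Z0 eq)
    have "coset B1 (a - m) = coset B1 a"
      using mn chain_subgroup_minus[OF q1.B] by (simp add: coset_eq_iff[OF q1.B])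
    moreover have "coset B2 (a - m) = coset B2 b"
      using mn by (simp add: eq coset_eq_iff[OF q2.B])
    ultimately have "u = ?\<phi> (coset B0 (a - m))" using \<phi>[OF c] ab by simp
    with c show "u \<in> ?\<phi> ` carrier Q0" unfolding carriers by blast
  next
    fix u assume "u \<in> ?\<phi> ` carrier Q0"
    then obtain c where c: "c \<in> Z0" "u = (coset B1 c, coset B2 c)" using \<phi> by (auto simp: carriers)
    then have cc: "c \<in> Z1" "c \<in> Z2" by (auto simp: Z0)
    have "?\<psi> u = coset B3 0" unfolding c(2) \<psi>[OF cc] by simp
    with c cc one show "u \<in> kernel (Q1 \<times>\<times> Q2) Q3 ?\<psi>" by (auto simp: kernel_def carriers)
  qed
  have image: "?\<psi> ` carrier (Q1 \<times>\<times> Q2) = carrier Q3"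
  proof
    show "?\<psi> ` carrier (Q1 \<times>\<times> Q2) \<subseteq> carrier Q3" using hom\<psi> by (auto simp only: hom_def Pi_iff mem_Collect_eq image_subset_iff)
    show "carrier Q3 \<subseteq> ?\<psi> ` carrier (Q1 \<times>\<times> Q2)"
    proof
      fix w assume "w \<in> carrier Q3"
      then obtain a b where ab: "a \<in> Z1" "b \<in> Z2" "w = coset B3 (a + b)" by (auto simp: carriers Z3)
      have "- b \<in> Z2" using ab chain_subgroup_minus[OF q2.Z] by blast
      then have "w = ?\<psi> (coset B1 a, coset B2 (- b))" "(coset B1 a, coset B2 (- b)) \<in> carrier (Q1 \<times>\<times> Q2)"
        using ab \<psi>[of a "- b"] by (simp_all add: carriers)
      then show "w \<in> ?\<psi> ` carrier (Q1 \<times>\<times> Q2)" by blast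
    qed
  qed
  show ?thesis
    unfolding right_exact_def group_hom_def group_hom_axioms_def
    by (intro conjI groups DirProd_group hom\<phi> hom\<psi> kernel image)
qed

lemma MPSS_map_coset:
  assumes G: "pair_loopfree_digraph G" and G': "pair_loopfree_digraph G'" and r: "2 \<le> r"
    and sub: "pverts G \<subseteq> pverts G'" "parcs G \<subseteq> parcs G'" and c: "c \<in> edge_cycles (parcs G)"
  shows "MPSS_map id G' (int r) 1 0 (coset (short_boundaries r G) c) = coset (short_boundaries r G') c"
proof -
  interpret G: pair_loopfree_digraph G by fact
  interpret G': pair_loopfree_digraph G' by fact
  let ?B = "short_boundaries r G" and ?B' = "short_boundaries r G'"
  have "?B' #>\<^bsub>RC G' 1\<^esub> RC_map id d = coset ?B' c" if "d \<in> coset ?B c" for d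
  proof -
    from that obtain b where b: "b \<in> ?B" "d = b + c" by (auto simp: coset_def)
    then have "d \<in> edge_cycles (parcs G)"
      using G.short_boundaries_subset_edge_cycles c chain_subgroup_add[OF chain_subgroup_edge_cycles] by blast
    then have "RC_map id d = d" by (rule G.RC_map_id)
    moreover have "d - c \<in> ?B'" using b short_boundaries_mono[OF G G' sub] by auto
    ultimately show ?thesis
      by (simp add: RC_def r_coset_eq_coset coset_eq_iff[OF chain_subgroup_short_boundaries])
  qed
  moreover have "c \<in> coset ?B c"
    using chain_subgroup_zero[OF chain_subgroup_short_boundaries] by (force simp: coset_def)
  ultimately have "(\<lambda>d. ?B' #>\<^bsub>RC G' 1\<^esub> RC_map id d) ` coset ?B c = {coset ?B' c}" by blast
  then show ?thesis by (simp add: MPSS_map_def G'.MPSS_B_eq_short_boundaries[OF r])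
qed

theorem corollary1p4:
  fixes X Y :: "'a pair_pre_digraph" and r :: nat
  assumes "pair_loopfree_digraph X" and "pair_loopfree_digraph Y"
    and "2 \<le> r"
    and "separable r X Y"
    and "zigzag_connected X" and "zigzag_connected Y" and "zigzag_connected (X \<inter>\<^sub>G Y)"
  shows "right_exact
    (MPSS_E (X \<inter>\<^sub>G Y) (int r) 1 0)
    (MPSS_E X (int r) 1 0 \<times>\<times> MPSS_E Y (int r) 1 0)
    (MPSS_E (X \<union>\<^sub>G Y) (int r) 1 0)
    (\<lambda>c. (MPSS_map id X (int r) 1 0 c, MPSS_map id Y (int r) 1 0 c))
    (\<lambda>(a, b). MPSS_map id (X \<union>\<^sub>G Y) (int r) 1 0 a
      \<otimes>\<^bsub>MPSS_E (X \<union>\<^sub>G Y) (int r) 1 0\<^esub>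
        inv\<^bsub>MPSS_E (X \<union>\<^sub>G Y) (int r) 1 0\<^esub> MPSS_map id (X \<union>\<^sub>G Y) (int r) 1 0 b)"
proof -
  note X = \<open>pair_loopfree_digraph X\<close> and Y = \<open>pair_loopfree_digraph Y\<close> and r = \<open>2 \<le> r\<close>
  interpret X: pair_loopfree_digraph X by fact
  interpret Y: pair_loopfree_digraph Y by fact
  have I: "pair_loopfree_digraph (X \<inter>\<^sub>G Y)" and U: "pair_loopfree_digraph (X \<union>\<^sub>G Y)"
    by (unfold_locales; auto simp: digraph_inter_def digraph_union_def
        dest: X.wellformed' Y.wellformed' X.no_loops' Y.no_loops')+
  interpret I: pair_loopfree_digraph "X \<inter>\<^sub>G Y" by fact
  interpret U: pair_loopfree_digraph "X \<union>\<^sub>G Y" by fact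
  have quotient: "chain_quotient (RC_gens G 1) (edge_cycles (parcs G)) (short_boundaries r G)"
    if "pair_loopfree_digraph G" for G :: "'a pair_pre_digraph"
    using chain_subgroup_edge_cycles chain_subgroup_short_boundaries
      pair_loopfree_digraph.short_boundaries_subset_edge_cycles[OF that]
      pair_loopfree_digraph.edge_cycle_in_RC[OF that] by (rule chain_quotient.intro)
  have page: "MPSS_E G (int r) 1 0
      = free_Abelian_group (RC_gens G 1)\<lparr>carrier := edge_cycles (parcs G)\<rparr> Mod short_boundaries r G"
    if "pair_loopfree_digraph G" for G :: "'a pair_pre_digraph"
    using that r by (simp add: MPSS_E_def RC_def pair_loopfree_digraph.MPSS_Z_eq_edge_cycles
        pair_loopfree_digraph.MPSS_B_eq_short_boundaries)
  have V: "pverts (X \<inter>\<^sub>G Y) \<subseteq> pverts X" "pverts (X \<inter>\<^sub>G Y) \<subseteq> pverts Y"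
    "pverts X \<subseteq> pverts (X \<union>\<^sub>G Y)" "pverts Y \<subseteq> pverts (X \<union>\<^sub>G Y)"
    and E: "parcs (X \<inter>\<^sub>G Y) \<subseteq> parcs X" "parcs (X \<inter>\<^sub>G Y) \<subseteq> parcs Y"
    "parcs X \<subseteq> parcs (X \<union>\<^sub>G Y)" "parcs Y \<subseteq> parcs (X \<union>\<^sub>G Y)"
    by (auto simp: digraph_inter_def digraph_union_def)
  have cycles: "edge_cycles (parcs (X \<union>\<^sub>G Y))
      = {a + b |a b. a \<in> edge_cycles (parcs X) \<and> b \<in> edge_cycles (parcs Y)}"
  proof (rule equalityI; rule subsetI)
    fix c assume "c \<in> edge_cycles (parcs (X \<union>\<^sub>G Y))"
    then have "c \<in> edge_cycles (parcs X \<union> parcs Y)" by (simp add: digraph_union_def)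
    then show "c \<in> {a + b |a b. a \<in> edge_cycles (parcs X) \<and> b \<in> edge_cycles (parcs Y)}"
      using edge_cycles_split[OF X.pair_wf_digraph_axioms Y.pair_wf_digraph_axioms assms(7)] by blast
  next
    fix c assume "c \<in> {a + b |a b. a \<in> edge_cycles (parcs X) \<and> b \<in> edge_cycles (parcs Y)}"
    then obtain a b where "a \<in> edge_cycles (parcs X)" "b \<in> edge_cycles (parcs Y)" "c = a + b" by blast
    with edge_cycles_mono[OF E(3)] edge_cycles_mono[OF E(4)]
    show "c \<in> edge_cycles (parcs (X \<union>\<^sub>G Y))"
      by (auto intro!: chain_subgroup_add[OF chain_subgroup_edge_cycles])
  qed
  have boundaries: "short_boundaries r (X \<union>\<^sub>G Y)
      = {a + b |a b. a \<in> short_boundaries r X \<and> b \<in> short_boundaries r Y}"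
  proof (rule equalityI; rule subsetI)
    fix c assume "c \<in> short_boundaries r (X \<union>\<^sub>G Y)"
    then show "c \<in> {a + b |a b. a \<in> short_boundaries r X \<and> b \<in> short_boundaries r Y}"
      using short_boundaries_union[OF X Y U \<open>separable r X Y\<close>] by blast
  next
    fix c assume "c \<in> {a + b |a b. a \<in> short_boundaries r X \<and> b \<in> short_boundaries r Y}"
    then obtain a b where "a \<in> short_boundaries r X" "b \<in> short_boundaries r Y" "c = a + b" by blast
    with short_boundaries_mono[OF X U V(3) E(3)] short_boundaries_mono[OF Y U V(4) E(4)]
    show "c \<in> short_boundaries r (X \<union>\<^sub>G Y)"
      by (auto intro!: chain_subgroup_add[OF chain_subgroup_short_boundaries])
  qed
  show ?thesis
    unfolding page[OF X] page[OF Y] page[OF I] page[OF U]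
  proof (rule right_exact_quotients[OF quotient[OF I] quotient[OF X] quotient[OF Y] quotient[OF U]])
    show "edge_cycles (parcs (X \<inter>\<^sub>G Y)) = edge_cycles (parcs X) \<inter> edge_cycles (parcs Y)"
      by (simp add: digraph_inter_def edge_cycles_Int)
  qed (use cycles boundaries short_boundaries_mono[OF I X V(1) E(1)] short_boundaries_mono[OF I Y V(2) E(2)]
      MPSS_map_coset[OF I X r V(1) E(1)] MPSS_map_coset[OF I Y r V(2) E(2)]
      MPSS_map_coset[OF X U r V(3) E(3)] MPSS_map_coset[OF Y U r V(4) E(4)] in simp_all)
qed

end
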